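(* Let $d,K,N\ge1$ be integers, $\ell\in\mathbb{N}_0$, $p\ge1$. Let $\pi_1,\ldots,\pi_K\ge 0$ with $\sum_k\pi_k=1$, $\mu_1,\ldots,\mu_K\in\mathbb{R}^d$, and let $\Sigma_1,\ldots,\Sigma_K$ be symmetric positive semidefinite (possibly singular) real $d\times d$ matrices. For $\eta>0$ let $P_\eta=\sum_{k=1}^K\pi_k N(\mu_k,\eta\Sigma_k)$ and let $X^{(\eta)}=(X^{(\eta)}_1,\ldots,X^{(\eta)}_N)$ be a random vector on a probability space $(\Omega,\mathcal F,\mathbb{P})$ of $\mathbb{R}^d$-valued random variables each with marginal distribution $P_\eta$ (not necessarily independent). Let $\mathcal{L}\in\{\mathcal{L}_{\ell,\mathrm{total}},\mathcal{L}_{\ell,\mathrm{max}}\}$. Then the family $\{\mathcal{L}(X^{(\eta)})/\sqrt{\eta}\}_{\eta\ge1}$ is tight on $\mathbb{R}$. In particular, for any $\varepsilon>0$ there exists $U_{\varepsilon,\ell,p}(N)>0$ such that $$\sup_{\eta\ge1}\mathbb{P}\left(\frac{\mathcal{L}(X^{(\eta)})}{\sqrt{\eta}}>U_{\varepsilon,\ell,p}(N)\right)<\varepsilon,$$ where, provided $C_{\ell,p}(N)>0$, we can choose $$U_{\varepsilon,\ell,p}(N):=\left(\frac{C_{\ell,p}(N)}{\varepsilon}\right)^{1/p},\qquad C_{\ell,p}(N):=(M_p+V_p)\,C^{\mathrm{VR}}_{\ell,p}(N),$$ with $$M_p=2^{p-1}\sum_{k=1}^K\pi_k\|\mu_k\|^p,\quad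 V_p=2^{p-1}\kappa_{d,p}\sum_{k=1}^K\pi_k(\mathrm{tr}\,\Sigma_k)^{p/2},\quad C^{\mathrm{VR}}_{\ell,p}(N)=2^pN\left(\min\left\{\tbinom{N}{\ell+1},\tbinom{N}{\ell+2}\right\}\right)^p .$$
   Context: $\|\cdot\|$ is the Euclidean norm. $N(\mu,\Sigma)$ denotes the Gaussian law with mean $\mu$ and covariance $\Sigma\succeq0$, i.e. the law of $\mu+\Sigma^{1/2}Z$ with $Z\sim N(0,I_d)$ and $\Sigma^{1/2}$ the positive semidefinite square root. $\kappa_{d,p}:=\mathbb{E}[\|Z\|^p]=2^{p/2}\Gamma(\frac{d+p}{2})/\Gamma(\frac d2)$ for $Z\sim N(0,I_d)$. For $x=(x_1,\ldots,x_N)\in(\mathbb{R}^d)^N$ the Vietoris--Rips filtration on the full simplex (all nonempty subsets $\sigma\subset\{1,\ldots,N\}$) is $\Phi_\sigma(x):=\max_{i,j\in\sigma}\|x_i-x_j\|$. $\mathcal{D}_\ell(x)$ denotes its persistence diagram in homological degree $\ell$ (coefficients in $\mathbb{Z}/2\mathbb{Z}$): the finite multiset of birth--death pairs $(b,d)$ with $b<d\le\infty$. Define $\mathcal{L}_{\ell,\mathrm{total}}(x)=\sum_{(b,d)\in\mathcal{D}_\ell(x),\,d<\infty}(d-b)$ (with multiplicities) and $\mathcal{L}_{\ell,\mathrm{max}}(x)=\max_{(b,d)\in\mathcal{D}_\ell(x),\,d<\infty}(d-b)$, both equal to $0$ if there is no finite pair. *)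

theory Defs
  imports
    "HOL-Probability.Probability"
    "HOL-Library.Poly_Mapping"
    "HOL-Library.Multiset"
    "HOL-Library.Z2"
begin

section \<open>Simplicial homology with coefficients in the field with two elements\<close>

text \<open>
  A simplex is a nonempty finite set of vertices, a complex is a set of simplices, and a chain is
  a finitely supported function from simplices to \<^typ>\<open>bit\<close>. Homology is unreduced: the boundary
  of a vertex is \<open>0\<close>, not the empty simplex.
\<close>

type_synonym chain = "nat set \<Rightarrow>\<^sub>0 bit"

definition chain_scale :: "bit \<Rightarrow> chain \<Rightarrow> chain" where
  "chain_scale a c = Poly_Mapping.map ((*) a) c"

lemma lookup_chain_scale [simp]:
  "Poly_Mapping.lookup (chain_scale a c) \<sigma> = a * Poly_Mapping.lookup c \<sigma>"
  by (cases "Poly_Mapping.lookup c \<sigma> = 0")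
    (simp_all add: chain_scale_def Poly_Mapping.map.rep_eq when_def)

lemma vector_space_chain_scale: "vector_space chain_scale"
proof unfold_locales
  fix a b :: bit and c c' :: chain
  show "chain_scale a (c + c') = chain_scale a c + chain_scale a c'"
    by (rule poly_mapping_eqI) (simp only: lookup_chain_scale lookup_add distrib_left)
  show "chain_scale (a + b) c = chain_scale a c + chain_scale b c"
    by (rule poly_mapping_eqI) (simp only: lookup_chain_scale lookup_add distrib_right)
  show "chain_scale a (chain_scale b c) = chain_scale (a * b) c"
    by (rule poly_mapping_eqI) (simp only: lookup_chain_scale mult.assoc)
  show "chain_scale 1 c = c"
    by (rule poly_mapping_eqI) (simp only: lookup_chain_scale mult_1_left)
qed

definition chain_dim :: "chain set \<Rightarrow> nat" where
  "chain_dim = vector_space.dim chain_scale"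

definition boundary :: "chain \<Rightarrow> chain" where
  "boundary c = (\<Sum>\<sigma>\<in>Poly_Mapping.keys c. \<Sum>v\<in>\<sigma>.
     if \<sigma> = {v} then 0 else Poly_Mapping.single (\<sigma> - {v}) (Poly_Mapping.lookup c \<sigma>))"

definition chains :: "nat set set \<Rightarrow> nat \<Rightarrow> chain set" where
  "chains C l = {c. Poly_Mapping.keys c \<subseteq> {\<sigma> \<in> C. card \<sigma> = l + 1}}"

definition cycles :: "nat set set \<Rightarrow> nat \<Rightarrow> chain set" where
  "cycles C l = {c \<in> chains C l. boundary c = 0}"

definition boundaries :: "nat set set \<Rightarrow> nat \<Rightarrow> chain set" where
  "boundaries C l = boundary ` chains C (l + 1)"

text \<open>
  For \<open>C \<subseteq> D\<close> this is the rank of the map from the \<open>l\<close>-th homology of \<open>C\<close> to that of \<open>D\<close> induced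
  by the inclusion. The image of this map is the quotient of \<open>cycles C l\<close> by
  \<open>cycles C l \<inter> boundaries D l\<close>, so the subtraction on natural numbers does not truncate.
\<close>

definition persistent_betti :: "nat set set \<Rightarrow> nat set set \<Rightarrow> nat \<Rightarrow> nat" where
  "persistent_betti C D l =
     chain_dim (cycles C l) - chain_dim (cycles C l \<inter> boundaries D l)"

section \<open>Persistence diagrams of filtrations of the full simplex\<close>

definition full_simplex :: "nat \<Rightarrow> nat set set" where
  "full_simplex N = {\<sigma>. \<sigma> \<noteq> {} \<and> \<sigma> \<subseteq> {1..N}}"

definition sublevel :: "nat \<Rightarrow> (nat set \<Rightarrow> real) \<Rightarrow> ereal \<Rightarrow> nat set set" where
  "sublevel N \<Phi> t = {\<sigma> \<in> full_simplex N. ereal (\<Phi> \<sigma>) \<le> t}"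

definition strict_sublevel :: "nat \<Rightarrow> (nat set \<Rightarrow> real) \<Rightarrow> ereal \<Rightarrow> nat set set" where
  "strict_sublevel N \<Phi> t = {\<sigma> \<in> full_simplex N. ereal (\<Phi> \<sigma>) < t}"

text \<open>
  The multiplicity of the pair \<open>(b, d)\<close>, for \<open>b < d\<close>, is given by the usual alternating sum of
  persistent Betti numbers: if \<open>a\<^sub>0 < \<dots> < a\<^sub>m\<close> are the values of the filtration, \<open>b = a\<^sub>i\<close> and
  \<open>d = a\<^sub>j\<close>, then the strict sublevel sets at \<open>b\<close> and \<open>d\<close> are the sublevel sets at the values
  preceding \<open>b\<close> and \<open>d\<close> (the empty complex for \<open>i = 0\<close>), and with \<open>\<beta> i j\<close> the rank of the map
  between the homology groups at \<open>a\<^sub>i\<close> and \<open>a\<^sub>j\<close> the multiplicity is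
  \<open>(\<beta> i (j-1) - \<beta> i j) - (\<beta> (i-1) (j-1) - \<beta> (i-1) j)\<close>. For \<open>d = \<infinity>\<close> the terms at \<open>j\<close> are \<open>0\<close>
  and the terms at \<open>j-1\<close> refer to the full simplex. The alternating sum is nonnegative for a
  filtration, so that \<^const>\<open>nat\<close> does not truncate.
\<close>

definition dying :: "nat \<Rightarrow> (nat set \<Rightarrow> real) \<Rightarrow> nat \<Rightarrow> nat set set \<Rightarrow> ereal \<Rightarrow> int" where
  "dying N \<Phi> l C d = int (persistent_betti C (strict_sublevel N \<Phi> d) l)
     - (if d = \<infinity> then 0 else int (persistent_betti C (sublevel N \<Phi> d) l))"

definition pair_multiplicity :: "nat \<Rightarrow> (nat set \<Rightarrow> real) \<Rightarrow> nat \<Rightarrow> real \<Rightarrow> ereal \<Rightarrow> nat" where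
  "pair_multiplicity N \<Phi> l b d =
     nat (dying N \<Phi> l (sublevel N \<Phi> b) d - dying N \<Phi> l (strict_sublevel N \<Phi> b) d)"

text \<open>
  Pairs in which \<open>b\<close>, or a finite \<open>d\<close>, is not a value of the filtration have multiplicity \<open>0\<close>,
  so the sum may be restricted to the finitely many values.
\<close>

definition persistence_diagram ::
  "nat \<Rightarrow> (nat set \<Rightarrow> real) \<Rightarrow> nat \<Rightarrow> (real \<times> ereal) multiset" where
  "persistence_diagram N \<Phi> l =
     (\<Sum>b\<in>\<Phi> ` full_simplex N.
        \<Sum>d\<in>{d \<in> insert \<infinity> (ereal ` \<Phi> ` full_simplex N). ereal b < d}.
          replicate_mset (pair_multiplicity N \<Phi> l b d) (b, d))"

definition vietoris_rips :: "(nat \<Rightarrow> 'a::real_normed_vector) \<Rightarrow> nat set \<Rightarrow> real" where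
  "vietoris_rips x \<sigma> = (MAX (i, j)\<in>\<sigma> \<times> \<sigma>. norm (x i - x j))"

definition vr_diagram ::
  "nat \<Rightarrow> nat \<Rightarrow> (nat \<Rightarrow> 'a::real_normed_vector) \<Rightarrow> (real \<times> ereal) multiset" where
  "vr_diagram N l x = persistence_diagram N (vietoris_rips x) l"

definition finite_lifetimes :: "(real \<times> ereal) multiset \<Rightarrow> real multiset" where
  "finite_lifetimes D = {# real_of_ereal d - b. (b, d) \<in># filter_mset (\<lambda>(b, d). d < \<infinity>) D #}"

definition L_total :: "nat \<Rightarrow> nat \<Rightarrow> (nat \<Rightarrow> 'a::real_normed_vector) \<Rightarrow> real" where
  "L_total N l x = \<Sum>\<^sub># (finite_lifetimes (vr_diagram N l x))"

definition L_max :: "nat \<Rightarrow> nat \<Rightarrow> (nat \<Rightarrow> 'a::real_normed_vector) \<Rightarrow> real" where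
  "L_max N l x =
     (if finite_lifetimes (vr_diagram N l x) = {#} then 0
      else Max (set_mset (finite_lifetimes (vr_diagram N l x))))"

section \<open>Gaussian mixtures\<close>

definition psd :: "real ^ 'd ^ 'd \<Rightarrow> bool" where
  "psd A \<longleftrightarrow> transpose A = A \<and> (\<forall>v. 0 \<le> v \<bullet> (A *v v))"

definition psd_sqrt :: "real ^ 'd ^ 'd \<Rightarrow> real ^ 'd ^ 'd" where
  "psd_sqrt A = (THE B. psd B \<and> B ** B = A)"

definition std_gaussian :: "(real ^ 'd) measure" where
  "std_gaussian = density lborel (\<lambda>z. ennreal (\<Prod>i\<in>UNIV. std_normal_density (z $ i)))"

definition gaussian :: "real ^ 'd \<Rightarrow> real ^ 'd ^ 'd \<Rightarrow> (real ^ 'd) measure" where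
  "gaussian \<mu> \<Sigma> = distr std_gaussian borel (\<lambda>z. \<mu> + psd_sqrt \<Sigma> *v z)"

definition gaussian_mixture ::
  "nat \<Rightarrow> (nat \<Rightarrow> real) \<Rightarrow> (nat \<Rightarrow> real ^ 'd) \<Rightarrow> (nat \<Rightarrow> real ^ 'd ^ 'd) \<Rightarrow> (real ^ 'd) measure"
where
  "gaussian_mixture K w \<mu> \<Sigma> = measure_of UNIV (sets borel)
     (\<lambda>A. \<Sum>k=1..K. ennreal (w k) * emeasure (gaussian (\<mu> k) (\<Sigma> k)) A)"

text \<open>The absolute moment of order \<open>p\<close> of the standard Gaussian law on \<^typ>\<open>real ^ 'd\<close>.\<close>

definition kappa :: "'d::finite itself \<Rightarrow> real \<Rightarrow> real" where
  "kappa _ p = (\<integral>z. norm (z :: real ^ 'd) powr p \<partial>std_gaussian)"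

section \<open>Tightness\<close>

text \<open>Tightness of the laws of a family of real random variables.\<close>

definition tight_family :: "'w measure \<Rightarrow> 'i set \<Rightarrow> ('i \<Rightarrow> 'w \<Rightarrow> real) \<Rightarrow> bool" where
  "tight_family M I Y \<longleftrightarrow>
     (\<forall>i\<in>I. Y i \<in> borel_measurable M) \<and>
     (\<forall>\<epsilon>>0. \<exists>C. compact C \<and> (\<forall>i\<in>I. measure (distr M borel (Y i)) (- C) < \<epsilon>))"

end

theory Submission
  imports Defs
begin

text \<open>
  For a fixed finite death time \<open>d\<close> the multiplicities of the pairs \<open>(b, d)\<close> telescope over the birth
  times, and the result is at most the increase at \<open>d\<close> of the dimension of the space of boundaries.
  Hence there are at most \<open>dim (im \<partial>) \<le> min (N choose (l + 1)) (N choose (l + 2))\<close> finite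
  pairs, each of lifetime at most the diameter of the point cloud. The \<open>p\<close>-th moment of the
  diameter is bounded by those of the marginals, \<open>\<parallel>\<Sigma>\<^sup>1\<^sup>/\<^sup>2 z\<parallel> \<le> (tr \<Sigma>)\<^sup>1\<^sup>/\<^sup>2 \<parallel>z\<parallel>\<close> controls the latter, and
  Markov's inequality concludes.
\<close>

text \<open>The counting rests on one fact of linear algebra: enlarging a space of cycles can only
  increase the dimension of its part that newly becomes boundaries at a given time. This excludes
  truncation in \<open>pair_multiplicity\<close> for finite deaths, and it bounds the sum over
  births. The increments of boundary dimension then telescope a second time, over the deaths.

  The obstacle on the probabilistic side is measurability: the diagram is indexed by filtration
  values, which move with the sample point. Sums and maxima are therefore rewritten over pairs of
  simplices, a fixed finite index set, and multiplicities are seen as functions of sublevel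
  complexes, which take finitely many values.

  \<open>psd_sqrt\<close> is a definite description and \<open>kappa\<close> a Bochner integral, so
  existence and uniqueness of the root, and integrability of the powers of the norm, must be proved
  before either has its intended meaning. No joint law of the points is prescribed, so the diameter
  is bounded by a sum over all points; this is the origin of the factor \<open>N\<close> in the
  constant.\<close>

section \<open>Counting the finite pairs of a persistence diagram\<close>

text \<open>The quotient of \<open>U0\<close> by \<open>U0 \<inter> W\<close> embeds into that of
  \<open>U\<close> by \<open>U \<inter> W\<close>; the inequality compares their dimensions, written
  additively to avoid subtraction on \<open>nat\<close>. The finite set \<open>E\<close> keeps the
  spaces finite-dimensional, since \<open>dim\<close> of a space with an infinite basis is
  0.\<close>

lemma (in vector_space) dim_diff_Int_mono:
  assumes U0: "subspace U0" and U: "subspace U" and W: "subspace W"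
    and sub: "U0 \<subseteq> U" and fin: "finite E" and UE: "U \<subseteq> span E"
  shows "dim U0 + dim (U \<inter> W) \<le> dim U + dim (U0 \<inter> W)"
proof -
  obtain A where A: "A \<subseteq> U0 \<inter> W" "independent A" "U0 \<inter> W \<subseteq> span A" "card A = dim (U0 \<inter> W)"
    by (rule basis_exists)
  obtain C where C: "A \<subseteq> C" "C \<subseteq> U0" "independent C" "U0 \<subseteq> span C"
    using A by (meson maximal_independent_subset_extend inf.boundedE)
  obtain D where D: "D \<subseteq> U \<inter> W" "independent D" "U \<inter> W \<subseteq> span D" "card D = dim (U \<inter> W)"
    by (rule basis_exists)
  have fC: "finite C" and fD: "finite D"
    using independent_span_bound[OF fin C(3)] independent_span_bound[OF fin D(2)] C(2) D(1) sub UE by auto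
  have spanA: "span A = U0 \<inter> W"
    using A U0 W subspace_inter span_subspace by metis
  \<comment> \<open>\<open>C - A\<close> is independent modulo \<open>W\<close>: a vector of
    \<open>span D\<close> that lies in \<open>U0\<close> lies in \<open>U0 \<inter> W\<close>, which
    is \<open>span A\<close>. Hence \<open>C - A\<close> can be added to the basis \<open>D\<close>
    of \<open>U \<inter> W\<close> inside \<open>U\<close>, and counting gives the claim.\<close>
  have ind: "independent (D \<union> B') \<and> D \<inter> B' = {}" if "finite B'" "B' \<subseteq> C - A" for B'
    using that
  proof (induction B')
    case empty
    then show ?case using D by simp
  next
    case (insert b B')
    have IH: "independent (D \<union> B')" "D \<inter> B' = {}" using insert by auto
    have bC: "b \<in> C" "b \<notin> A" and B'C: "B' \<subseteq> C" using insert by auto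
    have "b \<notin> span (D \<union> B')"
    proof
      assume "b \<in> span (D \<union> B')"
      then obtain x y where xy: "b = x + y" "x \<in> span D" "y \<in> span B'"
        unfolding span_Un by auto
      have "y \<in> U0"
        using xy(3) B'C C(2) U0 span_minimal by blast
      then have "x \<in> U0"
        using xy(1) bC C(2) U0 subspace_diff[of U0 b y] by auto
      moreover have "x \<in> W"
        using xy(2) D(1) W span_minimal[of D W] by blast
      ultimately have "x \<in> span A"
        using spanA by blast
      then have "b \<in> span (A \<union> B')"
        unfolding xy(1) by (intro span_add; use xy(3) span_mono[of A "A \<union> B'"] span_mono[of B' "A \<union> B'"] in blast)
      moreover have "A \<union> B' \<subseteq> C - {b}"
        using C(1) bC B'C insert.hyps by auto
      ultimately have "b \<in> span (C - {b})"
        using span_mono by blast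
      then show False
        using C(3) bC by (auto simp: dependent_def)
    qed
    then have "b \<notin> D \<union> B'" "independent (insert b (D \<union> B'))"
      using IH(1) span_base[of b "D \<union> B'"] independent_insert[of b "D \<union> B'"] by auto
    then show ?case
      using IH by auto
  qed
  have ind': "independent (D \<union> (C - A))" "D \<inter> (C - A) = {}"
    using ind[of "C - A"] fC by auto
  have "card (D \<union> (C - A)) \<le> dim U"
  proof -
    have "D \<union> (C - A) \<subseteq> U" using C D sub by auto
    then obtain B where B: "D \<union> (C - A) \<subseteq> B" "B \<subseteq> U" "independent B" "U \<subseteq> span B"
      using ind' by (meson maximal_independent_subset_extend)
    then have "finite B"
      using independent_span_bound[OF fin B(3)] UE by auto
    then show ?thesis
      using B(1) basis_card_eq_dim[OF B(2,4,3)] card_mono[of B "D \<union> (C - A)"] by simp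
  qed
  moreover have "card C = dim U0"
    using C basis_card_eq_dim by blast
  moreover have "card (D \<union> (C - A)) = card D + (card C - card A)"
    using ind' fC fD C(1) by (simp add: card_Un_disjoint card_Diff_subset finite_subset)
  moreover have "card A \<le> card C"
    using C fC card_mono by blast
  ultimately show ?thesis
    using A(4) D(4) by linarith
qed

lemma (in vector_space) dim_mono_finite_span:
  assumes "U \<subseteq> V" "V \<subseteq> span E" "finite E"
  shows "dim U \<le> dim V"
proof -
  obtain A where A: "A \<subseteq> U" "independent A" "U \<subseteq> span A" "card A = dim U"
    by (rule basis_exists)
  obtain B where B: "A \<subseteq> B" "B \<subseteq> V" "independent B" "V \<subseteq> span B"
    using A assms by (meson maximal_independent_subset_extend order_trans)
  have "finite B"
    using independent_span_bound[OF assms(3) B(3)] B(2) assms(2) by auto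
  then show ?thesis
    using A(4) B(1) basis_card_eq_dim[OF B(2,4,3)] card_mono[of B A] by simp
qed

section \<open>Chains, cycles and boundaries over the field with two elements\<close>

interpretation chain: vector_space chain_scale
  by (rule vector_space_chain_scale)

text \<open>The only scalars are 0 and 1, so closure under scaling follows from
  \<open>0 \<in> S\<close>.\<close>

lemma chain_subspaceI:
  assumes "0 \<in> S" "\<And>x y. x \<in> S \<Longrightarrow> y \<in> S \<Longrightarrow> x + y \<in> S"
  shows "chain.subspace S"
proof (rule chain.subspaceI)
  fix a :: bit and x assume "x \<in> S"
  then show "chain_scale a x \<in> S"
    using assms(1) by (cases a) auto
qed (use assms in auto)

text \<open>Cancellation can make the support of \<open>c + c'\<close> smaller than the union of the
  supports. Summing over a common finite superset makes additivity of \<open>boundary\<close> a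
  termwise statement.\<close>

lemma boundary_eq_sum:
  assumes "finite S" "Poly_Mapping.keys c \<subseteq> S"
  shows "boundary c = (\<Sum>\<sigma>\<in>S. \<Sum>v\<in>\<sigma>.
     if \<sigma> = {v} then 0 else Poly_Mapping.single (\<sigma> - {v}) (Poly_Mapping.lookup c \<sigma>))"
  unfolding boundary_def
  by (rule sum.mono_neutral_left) (use assms in \<open>auto simp: in_keys_iff intro!: sum.neutral\<close>)

lemma boundary_0 [simp]: "boundary 0 = 0"
  by (simp add: boundary_def)

lemma boundary_add: "boundary (c + c') = boundary c + boundary c'"
proof -
  let ?S = "Poly_Mapping.keys c \<union> Poly_Mapping.keys c'"
  have *: "finite ?S" "Poly_Mapping.keys (c + c') \<subseteq> ?S"
    by (auto simp: Poly_Mapping.keys_add)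
  show ?thesis
    unfolding boundary_eq_sum[OF *] boundary_eq_sum[OF *(1) Un_upper1] boundary_eq_sum[OF *(1) Un_upper2]
      sum.distrib[symmetric]
    by (intro sum.cong refl, rename_tac \<sigma> v, case_tac "\<sigma> = {v}")
      (simp_all only: if_True if_False lookup_add single_add add_0 simp_thms)
qed

lemma boundary_sum: "boundary (sum f S) = (\<Sum>x\<in>S. boundary (f x))"
  by (induction S rule: infinite_finite_induct) (auto simp: boundary_add)

text \<open>Every nonzero coefficient is 1, so a chain is determined by its support.\<close>

lemma chain_eq_sum_single:
  "c = (\<Sum>\<sigma>\<in>Poly_Mapping.keys c. Poly_Mapping.single \<sigma> (1 :: bit))"
proof (rule poly_mapping_eqI)
  fix \<sigma>
  have "Poly_Mapping.lookup c \<sigma> = (if \<sigma> \<in> Poly_Mapping.keys c then 1 else 0)"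
    by (cases "Poly_Mapping.lookup c \<sigma>") (auto simp: in_keys_iff)
  then show "Poly_Mapping.lookup c \<sigma> =
      Poly_Mapping.lookup (\<Sum>\<sigma>\<in>Poly_Mapping.keys c. Poly_Mapping.single \<sigma> (1 :: bit)) \<sigma>"
    by (simp add: lookup_sum lookup_single when_def)
qed

abbreviation simplices :: "nat set set \<Rightarrow> nat \<Rightarrow> nat set set" where
  "simplices C l \<equiv> {\<sigma> \<in> C. card \<sigma> = l + 1}"

lemma subspace_chains: "chain.subspace (chains C l)"
  by (rule chain_subspaceI)
    (auto simp: chains_def dest!: subsetD[OF Poly_Mapping.keys_add])

lemma subspace_cycles: "chain.subspace (cycles C l)"
  using subspace_chains[of C l]
  by (intro chain_subspaceI)
    (auto simp: cycles_def boundary_add chain.subspace_0 chain.subspace_add)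

lemma subspace_boundaries: "chain.subspace (boundaries C l)"
proof (rule chain_subspaceI)
  show "0 \<in> boundaries C l"
    unfolding boundaries_def using chain.subspace_0[OF subspace_chains] boundary_0 by (metis image_eqI)
next
  fix x y assume "x \<in> boundaries C l" "y \<in> boundaries C l"
  then obtain a b where "x = boundary a" "y = boundary b" "a \<in> chains C (l+1)" "b \<in> chains C (l+1)"
    unfolding boundaries_def by auto
  then show "x + y \<in> boundaries C l"
    unfolding boundaries_def using chain.subspace_add[OF subspace_chains] boundary_add by (metis image_eqI)
qed

lemma chains_subset_span:
  "chains C l \<subseteq> chain.span ((\<lambda>\<sigma>. Poly_Mapping.single \<sigma> 1) ` simplices C l)"
proof
  fix c assume "c \<in> chains C l"
  then show "c \<in> chain.span ((\<lambda>\<sigma>. Poly_Mapping.single \<sigma> 1) ` simplices C l)"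
    by (subst chain_eq_sum_single, intro chain.span_sum chain.span_base) (auto simp: chains_def)
qed

lemma boundaries_subset_span:
  "boundaries C l \<subseteq> chain.span ((\<lambda>\<sigma>. boundary (Poly_Mapping.single \<sigma> 1)) ` simplices C (l + 1))"
proof
  fix c assume "c \<in> boundaries C l"
  then obtain a where a: "a \<in> chains C (l + 1)" "c = boundary a"
    by (auto simp: boundaries_def)
  have "c = (\<Sum>\<sigma>\<in>Poly_Mapping.keys a. boundary (Poly_Mapping.single \<sigma> 1))"
    unfolding a(2) by (subst chain_eq_sum_single) (simp add: boundary_sum)
  also have "\<dots> \<in> chain.span ((\<lambda>\<sigma>. boundary (Poly_Mapping.single \<sigma> 1)) ` simplices C (l + 1))"
    using a(1) by (intro chain.span_sum chain.span_base) (auto simp: chains_def)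
  finally show "c \<in> chain.span ((\<lambda>\<sigma>. boundary (Poly_Mapping.single \<sigma> 1)) ` simplices C (l + 1))" .
qed

lemma finite_full_simplex: "finite (full_simplex N)"
  unfolding full_simplex_def by simp

lemma boundaries_full_simplex_subset_chains: "boundaries (full_simplex N) l \<subseteq> chains (full_simplex N) l"
proof
  fix c assume "c \<in> boundaries (full_simplex N) l"
  then obtain a where a: "a \<in> chains (full_simplex N) (l + 1)" "c = boundary a"
    by (auto simp: boundaries_def)
  show "c \<in> chains (full_simplex N) l"
    unfolding a(2) boundary_def
  proof (intro chain.subspace_sum[OF subspace_chains])
    fix \<sigma> v assume s: "\<sigma> \<in> Poly_Mapping.keys a" "v \<in> \<sigma>"
    then have "\<sigma> \<in> simplices (full_simplex N) (l + 1)"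
      using a by (auto simp: chains_def)
    then have "\<sigma> - {v} \<in> simplices (full_simplex N) l \<or> \<sigma> = {v}"
      using s(2) by (auto simp: full_simplex_def card_Diff_singleton_if)
    then show "(if \<sigma> = {v} then 0 else Poly_Mapping.single (\<sigma> - {v}) (Poly_Mapping.lookup a \<sigma>))
        \<in> chains (full_simplex N) l"
      using chain.subspace_0[OF subspace_chains]
      by (auto simp: chains_def split: if_splits)
  qed
qed

lemma card_simplices_full: "card (simplices (full_simplex N) l) = N choose (l + 1)"
proof -
  have "simplices (full_simplex N) l = {\<sigma>. \<sigma> \<subseteq> {1..N} \<and> card \<sigma> = l + 1}"
    by (auto simp: full_simplex_def)
  then show ?thesis
    by (simp add: n_subsets)
qed

text \<open>The two entries of the minimum come from two views of the boundaries: as a subspace of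
  the \<open>l\<close>-chains, and as the image of the \<open>(l + 1)\<close>-chains.\<close>

lemma chain_dim_boundaries_full_simplex:
  "chain_dim (boundaries (full_simplex N) l) \<le> min (N choose (l + 1)) (N choose (l + 2))"
proof -
  have *: "finite (simplices (full_simplex N) k)" for k
    using finite_full_simplex by simp
  have "chain.dim (boundaries (full_simplex N) l) \<le> card ((\<lambda>\<sigma>. Poly_Mapping.single \<sigma> (1::bit)) ` simplices (full_simplex N) l)"
    using boundaries_full_simplex_subset_chains chains_subset_span *
    by (intro chain.dim_le_card) (blast, simp)
  also have "\<dots> \<le> N choose (l + 1)"
    using card_image_le[OF *] card_simplices_full by metis
  finally have 1: "chain.dim (boundaries (full_simplex N) l) \<le> N choose (l + 1)" .
  have "chain.dim (boundaries (full_simplex N) l) \<le>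
      card ((\<lambda>\<sigma>. boundary (Poly_Mapping.single \<sigma> 1)) ` simplices (full_simplex N) (l + 1))"
    using boundaries_subset_span * by (intro chain.dim_le_card) (blast, simp)
  also have "\<dots> \<le> N choose (l + 2)"
    using card_image_le[OF *[of "l + 1"]] card_simplices_full[of N "l + 1"] by simp
  finally show ?thesis
    using 1 by (simp add: chain_dim_def)
qed

section \<open>Classes that die at a given time\<close>

lemma chains_mono: "C \<subseteq> D \<Longrightarrow> chains C l \<subseteq> chains D l"
  by (auto simp: chains_def)

lemma cycles_mono: "C \<subseteq> D \<Longrightarrow> cycles C l \<subseteq> cycles D l"
  unfolding cycles_def using chains_mono by blast

lemma boundaries_mono: "C \<subseteq> D \<Longrightarrow> boundaries C l \<subseteq> boundaries D l"
  unfolding boundaries_def by (intro image_mono chains_mono)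

text \<open>Finiteness of \<open>C\<close> makes \<open>chain_dim\<close> monotone on subspaces of
  the cycles, so the subtraction in \<open>persistent_betti\<close> is exact.\<close>

lemma int_persistent_betti:
  assumes "finite C"
  shows "int (persistent_betti C D l) =
    int (chain_dim (cycles C l)) - int (chain_dim (cycles C l \<inter> boundaries D l))"
proof -
  have "cycles C l \<subseteq> chain.span ((\<lambda>\<sigma>. Poly_Mapping.single \<sigma> 1) ` simplices C l)"
    using chains_subset_span by (auto simp: cycles_def)
  then have "chain_dim (cycles C l \<inter> boundaries D l) \<le> chain_dim (cycles C l)"
    unfolding chain_dim_def using assms
    by (intro chain.dim_mono_finite_span) auto
  then show ?thesis
    by (simp add: persistent_betti_def)
qed

text \<open>Both Betti numbers contain \<open>chain_dim (cycles C l)\<close>, which cancels. What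
  remains is the growth at \<open>d\<close> of the space of cycles of \<open>C\<close> that bound.
  For \<open>d = \<infinity>\<close> the second Betti number is absent and nothing cancels.\<close>

lemma dying_finite:
  assumes "d < \<infinity>" "finite C"
  shows "dying N \<Phi> l C d = int (chain_dim (cycles C l \<inter> boundaries (sublevel N \<Phi> d) l))
    - int (chain_dim (cycles C l \<inter> boundaries (strict_sublevel N \<Phi> d) l))"
  using assms by (simp add: dying_def int_persistent_betti)

lemma finite_sublevel: "finite (sublevel N \<Phi> t)" "finite (strict_sublevel N \<Phi> t)"
  using finite_full_simplex by (simp_all add: sublevel_def strict_sublevel_def)

lemma strict_sublevel_subset: "strict_sublevel N \<Phi> t \<subseteq> sublevel N \<Phi> t"
  unfolding sublevel_def strict_sublevel_def by (intro Collect_mono) (blast intro: less_imp_le)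

text \<open>This is \<open>dim_diff_Int_mono\<close> for the subspaces \<open>Z\<close> and
  \<open>Z'\<close> cut down to \<open>boundaries D l\<close>, with \<open>boundaries D' l\<close>
  as \<open>W\<close>. Since the intersection with \<open>boundaries D l\<close> is
  finite-dimensional, \<open>Z'\<close> may be all of \<open>UNIV\<close>, which is how the
  restriction to cycles is dropped later.\<close>

lemma chain_dim_diff_mono:
  assumes "chain.subspace Z" "chain.subspace Z'" "Z \<subseteq> Z'" "D' \<subseteq> D" "finite D"
  shows "int (chain_dim (Z \<inter> boundaries D l)) - int (chain_dim (Z \<inter> boundaries D' l))
    \<le> int (chain_dim (Z' \<inter> boundaries D l)) - int (chain_dim (Z' \<inter> boundaries D' l))"
proof -
  let ?E = "(\<lambda>\<sigma>. boundary (Poly_Mapping.single \<sigma> 1)) ` simplices D (l + 1)"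
  have "chain.dim (Z \<inter> boundaries D l) + chain.dim (Z' \<inter> boundaries D l \<inter> boundaries D' l)
      \<le> chain.dim (Z' \<inter> boundaries D l) + chain.dim (Z \<inter> boundaries D l \<inter> boundaries D' l)"
    by (rule chain.dim_diff_Int_mono[where E = ?E])
      (use assms boundaries_subset_span[of D l] in
        \<open>auto intro!: chain.subspace_inter subspace_boundaries\<close>)
  moreover have "Y \<inter> boundaries D l \<inter> boundaries D' l = Y \<inter> boundaries D' l" for Y
    using boundaries_mono[OF assms(4), of l] by auto
  ultimately show ?thesis
    by (simp add: chain_dim_def)
qed

lemma dying_mono:
  assumes "d < \<infinity>" "C \<subseteq> C'" "finite C'"
  shows "dying N \<Phi> l C d \<le> dying N \<Phi> l C' d"
proof -
  have "finite C"
    using finite_subset[OF assms(2,3)] .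
  then show ?thesis
    unfolding dying_finite[OF assms(1,3)] dying_finite[OF assms(1) \<open>finite C\<close>]
    by (intro chain_dim_diff_mono[OF subspace_cycles subspace_cycles cycles_mono[OF assms(2)]
          strict_sublevel_subset finite_sublevel(1)])
qed

text \<open>\<open>dying_mono\<close> makes the alternating sum nonnegative, so \<open>nat\<close>
  does not truncate.\<close>

lemma int_pair_multiplicity:
  assumes "d < \<infinity>"
  shows "int (pair_multiplicity N \<Phi> l b d) =
    dying N \<Phi> l (sublevel N \<Phi> b) d - dying N \<Phi> l (strict_sublevel N \<Phi> b) d"
proof -
  have "dying N \<Phi> l (strict_sublevel N \<Phi> b) d \<le> dying N \<Phi> l (sublevel N \<Phi> b) d"
    by (rule dying_mono[OF assms strict_sublevel_subset finite_sublevel(1)])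
  then show ?thesis
    unfolding pair_multiplicity_def by linarith
qed

text \<open>For \<open>V\<close> an initial segment of the values of \<Phi>, the strict sublevel set
  at one value is the sublevel set at the preceding one. The lemma serves twice: for births with
  \<open>h\<close> a \<open>dying\<close> number, and for deaths with \<open>h\<close> a dimension
  of boundaries.\<close>

lemma sum_sublevel_telescope:
  fixes \<Phi> :: "'a \<Rightarrow> real" and h :: "'a set \<Rightarrow> int"
  assumes "finite V" "V \<subseteq> \<Phi> ` F" "\<And>\<sigma> b. \<sigma> \<in> F \<Longrightarrow> b \<in> V \<Longrightarrow> \<Phi> \<sigma> \<le> b \<Longrightarrow> \<Phi> \<sigma> \<in> V"
  shows "(\<Sum>b\<in>V. h {\<sigma>\<in>F. \<Phi> \<sigma> \<le> b} - h {\<sigma>\<in>F. \<Phi> \<sigma> < b}) = h {\<sigma>\<in>F. \<Phi> \<sigma> \<in> V} - h {}"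
  using assms
proof (induction V rule: finite_linorder_max_induct)
  case empty
  then show ?case by simp
next
  case (insert b A)
  \<comment> \<open>\<open>b\<close> is the largest element and \<open>V\<close> is closed
    downwards, so the values below \<open>b\<close> are exactly those in \<open>A\<close>.\<close>
  have lt: "\<Phi> \<sigma> < b \<longleftrightarrow> \<Phi> \<sigma> \<in> A" if "\<sigma> \<in> F" for \<sigma>
    using insert.prems(2)[OF that insertI1] insert.hyps(2) by (metis insertE less_imp_le less_irrefl)
  have le: "\<Phi> \<sigma> \<le> b \<longleftrightarrow> \<Phi> \<sigma> \<in> insert b A" if "\<sigma> \<in> F" for \<sigma>
    using lt[OF that] by (simp add: le_less disj_commute)
  have "\<Phi> \<sigma> \<in> A" if "\<sigma> \<in> F" "a \<in> A" "\<Phi> \<sigma> \<le> a" for \<sigma> a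
    using lt[OF that(1)] insert.hyps(2) that(2,3) by (meson le_less_trans)
  then have IH: "(\<Sum>b\<in>A. h {\<sigma>\<in>F. \<Phi> \<sigma> \<le> b} - h {\<sigma>\<in>F. \<Phi> \<sigma> < b}) = h {\<sigma>\<in>F. \<Phi> \<sigma> \<in> A} - h {}"
    using insert.prems(1) by (intro insert.IH) auto
  have 1: "{\<sigma>\<in>F. \<Phi> \<sigma> \<le> b} = {\<sigma>\<in>F. \<Phi> \<sigma> \<in> insert b A}"
    using le by (intro Collect_cong conj_cong refl)
  have 2: "{\<sigma>\<in>F. \<Phi> \<sigma> < b} = {\<sigma>\<in>F. \<Phi> \<sigma> \<in> A}"
    using lt by (intro Collect_cong conj_cong refl)
  have "b \<notin> A"
    using insert.hyps(2) by auto
  then show ?case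
    unfolding sum.insert[OF insert.hyps(1) \<open>b \<notin> A\<close>] IH 1 2 by (simp only: diff_add_eq diff_diff_eq2 algebra_simps)
qed

section \<open>Telescoping over births and over deaths\<close>

lemma sublevel_real:
  "sublevel N \<Phi> (ereal b) = {\<sigma> \<in> full_simplex N. \<Phi> \<sigma> \<le> b}"
  "strict_sublevel N \<Phi> (ereal b) = {\<sigma> \<in> full_simplex N. \<Phi> \<sigma> < b}"
  by (auto simp: sublevel_def strict_sublevel_def)

lemma sum_pair_multiplicity_birth:
  "(\<Sum>b\<in>{b \<in> \<Phi> ` full_simplex N. b < d}. int (pair_multiplicity N \<Phi> l b (ereal d))) \<le>
    int (chain_dim (boundaries (sublevel N \<Phi> d) l))
     - int (chain_dim (boundaries (strict_sublevel N \<Phi> d) l))"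
proof -
  let ?F = "full_simplex N"
  let ?V = "{b \<in> \<Phi> ` ?F. b < d}"
  let ?h = "\<lambda>C. dying N \<Phi> l C (ereal d)"
  have fin: "finite ?V"
    using finite_full_simplex by simp
  have "(\<Sum>b\<in>?V. int (pair_multiplicity N \<Phi> l b (ereal d))) =
      (\<Sum>b\<in>?V. ?h {\<sigma>\<in>?F. \<Phi> \<sigma> \<le> b} - ?h {\<sigma>\<in>?F. \<Phi> \<sigma> < b})"
    by (simp add: int_pair_multiplicity sublevel_real)
  also have "\<dots> = ?h {\<sigma>\<in>?F. \<Phi> \<sigma> \<in> ?V} - ?h {}"
    by (rule sum_sublevel_telescope[OF fin]) auto
  also have "{\<sigma>\<in>?F. \<Phi> \<sigma> \<in> ?V} = strict_sublevel N \<Phi> d"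
    by (auto simp: sublevel_real)
  \<comment> \<open>The empty complex has no nonzero cycle, so the lower end of the telescope
    vanishes.\<close>
  also have "?h (strict_sublevel N \<Phi> d) - ?h {} \<le> ?h (strict_sublevel N \<Phi> d)"
  proof -
    have "cycles {} l = {0}"
      by (auto simp: cycles_def chains_def)
    then have "cycles {} l \<inter> boundaries D l = {0}" for D
      using chain.subspace_0[OF subspace_boundaries] by auto
    then show ?thesis
      by (simp add: dying_finite)
  qed
  \<comment> \<open>Replacing the cycles of the strict sublevel complex by \<open>UNIV\<close> also
    admits classes born at \<open>d\<close> itself. These have lifetime 0 and are no pairs of the
    diagram, so only an inequality can be expected.\<close>
  also have "\<dots> \<le> int (chain_dim (UNIV \<inter> boundaries (sublevel N \<Phi> d) l))
     - int (chain_dim (UNIV \<inter> boundaries (strict_sublevel N \<Phi> d) l))"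
    by (simp only: dying_finite less_ereal.simps finite_sublevel, rule chain_dim_diff_mono)
      (simp_all add: finite_sublevel subspace_cycles strict_sublevel_subset)
  finally show ?thesis by simp
qed

text \<open>The bounds for the single death times are increments of the dimension of the boundaries,
  so they add up to the dimension for the full simplex.\<close>

lemma sum_finite_pair_multiplicity:
  "(\<Sum>d\<in>\<Phi> ` full_simplex N. \<Sum>b\<in>{b \<in> \<Phi> ` full_simplex N. b < d}.
      pair_multiplicity N \<Phi> l b (ereal d)) \<le> min (N choose (l + 1)) (N choose (l + 2))"
proof -
  let ?F = "full_simplex N"
  let ?h = "\<lambda>C. int (chain_dim (boundaries C l))"
  have "int (\<Sum>d\<in>\<Phi> ` ?F. \<Sum>b\<in>{b \<in> \<Phi> ` ?F. b < d}. pair_multiplicity N \<Phi> l b (ereal d))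
      \<le> (\<Sum>d\<in>\<Phi> ` ?F. ?h {\<sigma>\<in>?F. \<Phi> \<sigma> \<le> d} - ?h {\<sigma>\<in>?F. \<Phi> \<sigma> < d})"
    unfolding of_nat_sum
    by (intro sum_mono order_trans[OF sum_pair_multiplicity_birth]) (simp add: sublevel_real)
  also have "\<dots> = ?h {\<sigma>\<in>?F. \<Phi> \<sigma> \<in> \<Phi> ` ?F} - ?h {}"
    using finite_full_simplex by (intro sum_sublevel_telescope) auto
  also have "{\<sigma>\<in>?F. \<Phi> \<sigma> \<in> \<Phi> ` ?F} = ?F"
    by auto
  finally show ?thesis
    using chain_dim_boundaries_full_simplex[of N l] by linarith
qed

section \<open>Lifetimes and their bounds\<close>

lemma finite_lifetimes_empty [simp]: "finite_lifetimes {#} = {#}"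
  by (simp add: finite_lifetimes_def)

lemma finite_lifetimes_add: "finite_lifetimes (D + D') = finite_lifetimes D + finite_lifetimes D'"
  by (simp add: finite_lifetimes_def)

lemma finite_lifetimes_sum: "finite_lifetimes (sum f S) = (\<Sum>x\<in>S. finite_lifetimes (f x))"
  by (induction S rule: infinite_finite_induct) (auto simp: finite_lifetimes_add)

lemma finite_lifetimes_replicate:
  "finite_lifetimes (replicate_mset n (b, d)) =
    (if d < \<infinity> then replicate_mset n (real_of_ereal d - b) else {#})"
  by (induction n) (auto simp: finite_lifetimes_def)

lemma finite_lifetimes_persistence_diagram:
  "finite_lifetimes (persistence_diagram N \<Phi> l) =
    (\<Sum>b\<in>\<Phi> ` full_simplex N. \<Sum>d\<in>{d \<in> \<Phi> ` full_simplex N. b < d}.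
       replicate_mset (pair_multiplicity N \<Phi> l b (ereal d)) (d - b))"
  unfolding persistence_diagram_def finite_lifetimes_sum
proof (intro sum.cong refl)
  fix b
  let ?V = "\<Phi> ` full_simplex N"
  let ?D = "{d \<in> insert \<infinity> (ereal ` ?V). ereal b < d}"
  have fin: "finite ?D"
    using finite_full_simplex by simp
  have "(\<Sum>d\<in>?D. finite_lifetimes (replicate_mset (pair_multiplicity N \<Phi> l b d) (b, d))) =
      (\<Sum>d\<in>ereal ` {d \<in> ?V. b < d}. finite_lifetimes (replicate_mset (pair_multiplicity N \<Phi> l b d) (b, d)))"
    by (rule sum.mono_neutral_right[OF fin]) (auto simp: finite_lifetimes_replicate)
  also have "\<dots> = (\<Sum>d\<in>{d \<in> ?V. b < d}.
       finite_lifetimes (replicate_mset (pair_multiplicity N \<Phi> l b (ereal d)) (b, ereal d)))"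
    by (subst sum.reindex) (auto intro: inj_onI)
  finally show "(\<Sum>d\<in>?D. finite_lifetimes (replicate_mset (pair_multiplicity N \<Phi> l b d) (b, d))) =
      (\<Sum>d\<in>{d \<in> ?V. b < d}. replicate_mset (pair_multiplicity N \<Phi> l b (ereal d)) (d - b))"
    by (simp add: finite_lifetimes_replicate)
qed

lemma sum_mset_sum: "\<Sum>\<^sub># (sum f S) = (\<Sum>x\<in>S. \<Sum>\<^sub># (f x))"
  by (induction S rule: infinite_finite_induct) auto

lemma set_mset_sum: "finite S \<Longrightarrow> set_mset (sum f S) = (\<Union>x\<in>S. set_mset (f x))"
  by (induction S rule: finite_induct) auto

lemma sum_mset_finite_lifetimes:
  "\<Sum>\<^sub># (finite_lifetimes (persistence_diagram N \<Phi> l)) =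
    (\<Sum>b\<in>\<Phi> ` full_simplex N. \<Sum>d\<in>{d \<in> \<Phi> ` full_simplex N. b < d}.
       real (pair_multiplicity N \<Phi> l b (ereal d)) * (d - b))"
  by (simp add: finite_lifetimes_persistence_diagram sum_mset_sum)

lemma set_mset_finite_lifetimes:
  "set_mset (finite_lifetimes (persistence_diagram N \<Phi> l)) =
    {d - b | b d. b \<in> \<Phi> ` full_simplex N \<and> d \<in> \<Phi> ` full_simplex N \<and> b < d \<and>
       0 < pair_multiplicity N \<Phi> l b (ereal d)}"
proof -
  have fin: "finite {d \<in> \<Phi> ` full_simplex N. b < d}" "finite (\<Phi> ` full_simplex N)" for b
    using finite_full_simplex by auto
  show ?thesis
    unfolding finite_lifetimes_persistence_diagram set_mset_sum[OF fin(1)] set_mset_sum[OF fin(2)]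
      set_mset_replicate_mset_subset
    by (auto split: if_splits)
qed

lemma sum_mset_finite_lifetimes_le:
  assumes "\<And>\<sigma>. \<sigma> \<in> full_simplex N \<Longrightarrow> 0 \<le> \<Phi> \<sigma>" "\<And>\<sigma>. \<sigma> \<in> full_simplex N \<Longrightarrow> \<Phi> \<sigma> \<le> D" "0 \<le> D"
  shows "\<Sum>\<^sub># (finite_lifetimes (persistence_diagram N \<Phi> l)) \<le>
    real (min (N choose (l + 1)) (N choose (l + 2))) * D"
proof -
  let ?V = "\<Phi> ` full_simplex N"
  let ?m = "\<lambda>b d. pair_multiplicity N \<Phi> l b (ereal d)"
  have fin: "finite ?V"
    using finite_full_simplex by auto
  have "\<Sum>\<^sub># (finite_lifetimes (persistence_diagram N \<Phi> l))
      \<le> (\<Sum>b\<in>?V. \<Sum>d\<in>{d \<in> ?V. b < d}. real (?m b d) * D)"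
    unfolding sum_mset_finite_lifetimes
  proof (intro sum_mono mult_left_mono)
    fix b d assume "b \<in> ?V" "d \<in> {d \<in> ?V. b < d}"
    then have "0 \<le> b" "d \<le> D" using assms by auto
    then show "d - b \<le> D" by simp
  qed simp
  also have "\<dots> = real (\<Sum>b\<in>?V. \<Sum>d\<in>{d \<in> ?V. b < d}. ?m b d) * D"
    by (simp add: sum_distrib_right)
  \<comment> \<open>The diagram sums over births first, the count of pairs over deaths
    first.\<close>
  also have "(\<Sum>b\<in>?V. \<Sum>d\<in>{d \<in> ?V. b < d}. ?m b d) = (\<Sum>d\<in>?V. \<Sum>b\<in>{b \<in> ?V. b < d}. ?m b d)"
    by (rule sum.swap_restrict[OF fin fin])
  also have "real \<dots> * D \<le> real (min (N choose (l + 1)) (N choose (l + 2))) * D"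
    using sum_finite_pair_multiplicity assms(3) by (intro mult_right_mono of_nat_mono)
  finally show ?thesis .
qed

lemma sum_mset_nonneg: "(\<And>y. y \<in># D \<Longrightarrow> 0 \<le> y) \<Longrightarrow> 0 \<le> \<Sum>\<^sub># (D :: real multiset)"
  by (induction D) auto

lemma member_le_sum_mset:
  assumes "\<And>y. y \<in># D \<Longrightarrow> 0 \<le> y" "x \<in># D"
  shows "x \<le> \<Sum>\<^sub># (D :: real multiset)"
proof -
  obtain D' where "D = add_mset x D'"
    using assms(2) multi_member_split by metis
  then show ?thesis
    using assms(1) sum_mset_nonneg[of D'] by simp
qed

text \<open>Recorded pairs satisfy \<open>b < d\<close>, so all lifetimes are nonnegative and the
  largest one is dominated by the sum. Upper bounds are thus needed for \<open>L_total\<close>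
  only.\<close>

lemma L_max_bounds: "0 \<le> L_max N l x" "L_max N l x \<le> L_total N l x"
proof -
  let ?D = "finite_lifetimes (vr_diagram N l x)"
  have nn: "0 \<le> y" if "y \<in># ?D" for y
    using that unfolding vr_diagram_def set_mset_finite_lifetimes by auto
  have mem: "Max (set_mset ?D) \<in># ?D" if "?D \<noteq> {#}"
    using that by simp
  show "0 \<le> L_max N l x"
    using nn mem by (auto simp: L_max_def)
  have "y \<le> \<Sum>\<^sub># ?D" if "y \<in># ?D" for y
    using nn that by (rule member_le_sum_mset)
  moreover have "0 \<le> \<Sum>\<^sub># ?D"
    using nn by (rule sum_mset_nonneg)
  ultimately show "L_max N l x \<le> L_total N l x"
    using mem by (auto simp: L_max_def L_total_def)
qed

section \<open>Bounds by the diameter and its moments\<close>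

lemma vietoris_rips_nonneg:
  assumes "\<sigma> \<in> full_simplex N"
  shows "0 \<le> vietoris_rips x \<sigma>"
proof -
  obtain i where "i \<in> \<sigma>" "finite \<sigma>"
    using assms finite_subset by (fastforce simp: full_simplex_def)
  then have "norm (x i - x i) \<le> vietoris_rips x \<sigma>"
    unfolding vietoris_rips_def by (intro Max_ge) (auto intro!: image_eqI[of _ _ "(i, i)"])
  then show ?thesis by simp
qed

lemma vietoris_rips_mono:
  assumes "\<sigma> \<subseteq> \<tau>" "\<sigma> \<noteq> {}" "finite \<tau>"
  shows "vietoris_rips x \<sigma> \<le> vietoris_rips x \<tau>"
  unfolding vietoris_rips_def using assms by (intro Max_mono) auto

lemma L_bounds:
  assumes "L \<in> {L_total N l, L_max N l}" "N \<ge> 1"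
  shows "0 \<le> L x"
    "L x \<le> real (min (N choose (l + 1)) (N choose (l + 2))) * vietoris_rips x {1..N}"
proof -
  have "L_total N l x \<le> real (min (N choose (l + 1)) (N choose (l + 2))) * vietoris_rips x {1..N}"
    unfolding L_total_def vr_diagram_def
    using assms(2) by (intro sum_mset_finite_lifetimes_le vietoris_rips_nonneg vietoris_rips_mono)
      (auto simp: full_simplex_def intro!: vietoris_rips_nonneg[of _ N])
  then show "0 \<le> L x"
    "L x \<le> real (min (N choose (l + 1)) (N choose (l + 2))) * vietoris_rips x {1..N}"
    using assms(1) L_max_bounds[of N l x] by auto
qed

text \<open>Convexity at the midpoint of \<open>a\<close> and \<open>b\<close>, multiplied by
  \<open>2 powr p\<close>. It is applied to the diameter and to the splitting of a Gaussian vector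
  into mean and fluctuation, which explains the powers of 2 in the constants.\<close>

lemma powr_sum_le:
  assumes "p \<ge> 1" "0 \<le> a" "0 \<le> (b::real)"
  shows "(a + b) powr p \<le> 2 powr (p - 1) * (a powr p + b powr p)"
proof (cases "a = 0 \<or> b = 0")
  case True
  moreover have "1 \<le> 2 powr (p - 1)"
    using assms by (intro ge_one_powr_ge_zero) auto
  ultimately show ?thesis
    by (auto simp: mult_le_cancel_right1)
next
  case False
  then have "((1 - 1/2) *\<^sub>R a + (1/2) *\<^sub>R b) powr p \<le> (1 - 1/2) * a powr p + (1/2) * b powr p"
    using assms by (intro convex_onD[OF powr_convex]) auto
  then have "((a + b) / 2) powr p \<le> (a powr p + b powr p) / 2"
    by (simp add: field_simps)
  then show ?thesis
    using assms by (simp add: powr_divide powr_diff field_simps)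
qed

text \<open>Since the maximum is attained at a pair of distinct indices unless it is \<open>0\<close>, the bound is
  smaller by a factor of \<open>2\<close> than the one obtained from \<open>norm (x i - x j) \<le> 2 * (MAX k. norm (x k))\<close>.
  This factor makes the final inequality strict, uniformly in \<open>\<eta>\<close>.\<close>

lemma vietoris_rips_powr_le:
  assumes "p \<ge> 1" "N \<ge> 1"
  shows "vietoris_rips x {1..N} powr p \<le> 2 powr (p - 1) * (\<Sum>i=1..N. norm (x i) powr p)"
proof -
  have "vietoris_rips x {1..N} \<in> (\<lambda>(i, j). norm (x i - x j)) ` ({1..N} \<times> {1..N})"
    unfolding vietoris_rips_def using assms(2) by (intro Max_in) auto
  then obtain i j where ij: "i \<in> {1..N}" "j \<in> {1..N}" "vietoris_rips x {1..N} = norm (x i - x j)"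
    by auto
  show ?thesis
  proof (cases "i = j")
    case True
    then show ?thesis
      using ij by (simp add: sum_nonneg)
  next
    case False
    have "norm (x i - x j) powr p \<le> (norm (x i) + norm (x j)) powr p"
      using assms by (intro powr_mono2 norm_triangle_ineq4) auto
    also have "\<dots> \<le> 2 powr (p - 1) * (norm (x i) powr p + norm (x j) powr p)"
      using assms by (intro powr_sum_le) auto
    also have "norm (x i) powr p + norm (x j) powr p = (\<Sum>k\<in>{i, j}. norm (x k) powr p)"
      using False by simp
    also have "\<dots> \<le> (\<Sum>i=1..N. norm (x i) powr p)"
      using ij by (intro sum_mono2) auto
    finally show ?thesis
      using ij(3) by simp
  qed
qed

section \<open>Measurability\<close>

lemma sum_image_eq_weighted:
  fixes g :: "'b \<Rightarrow> real"
  assumes "finite S"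
  shows "(\<Sum>y\<in>f ` S. g y) = (\<Sum>x\<in>S. g (f x) / real (card {x'\<in>S. f x' = f x}))"
proof -
  have "(\<Sum>x\<in>S. g (f x) / real (card {x'\<in>S. f x' = f x})) =
      (\<Sum>y\<in>f ` S. \<Sum>x\<in>{x\<in>S. f x = y}. g (f x) / real (card {x'\<in>S. f x' = f x}))"
    by (rule sum.image_gen[OF assms])
  also have "\<dots> = (\<Sum>y\<in>f ` S. g y)"
  proof (rule sum.cong[OF refl])
    fix y assume "y \<in> f ` S"
    then have "card {x'\<in>S. f x' = y} \<noteq> 0"
      using assms by (auto simp: card_eq_0_iff)
    then show "(\<Sum>x\<in>{x\<in>S. f x = y}. g (f x) / real (card {x'\<in>S. f x' = f x})) = g y"
      by simp
  qed
  finally show ?thesis ..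
qed

text \<open>The counterpart for maxima: over a fixed index set, pairs absent from the diagram
  contribute 0. This is harmless for nonnegative lifetimes and agrees with the default value of an
  empty diagram.\<close>

lemma Max_insert_0_eq:
  fixes S T :: "real set"
  assumes "finite T" "T \<noteq> {}" "S \<subseteq> T" "T \<subseteq> insert 0 S" "\<And>y. y \<in> S \<Longrightarrow> 0 \<le> y"
  shows "Max T = (if S = {} then 0 else Max S)"
proof (cases "S = {}")
  case True
  then have "T = {0}" using assms by auto
  then show ?thesis using True by simp
next
  case False
  have finS: "finite S" using assms finite_subset by blast
  have "Max S \<in> S" using finS False by simp
  then have "0 \<le> Max S" using assms(5) by blast
  have "Max T = Max S"
  proof (rule antisym)
    show "Max S \<le> Max T" using assms False by (intro Max_mono) auto
    show "Max T \<le> Max S"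
      using assms finS \<open>0 \<le> Max S\<close> by (intro Max.boundedI) (auto dest!: subsetD)
  qed
  then show ?thesis using False by simp
qed

context
  fixes M :: "'w measure" and \<Phi> :: "'w \<Rightarrow> nat set \<Rightarrow> real" and N :: nat
  assumes \<Phi>: "\<And>\<sigma>. \<sigma> \<in> full_simplex N \<Longrightarrow> (\<lambda>\<omega>. \<Phi> \<omega> \<sigma>) \<in> borel_measurable M"
begin

text \<open>As a random variable the complex takes values in the finite set
  \<open>Pow (full_simplex N)\<close>, and each of its fibres is described by finitely many
  comparisons between values of \<Phi>.\<close>

lemma simple_function_sublevel:
  assumes "\<sigma> \<in> full_simplex N"
  shows "simple_function M (\<lambda>\<omega>. sublevel N (\<Phi> \<omega>) (ereal (\<Phi> \<omega> \<sigma>)))" (is "simple_function M ?s")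
    and "simple_function M (\<lambda>\<omega>. strict_sublevel N (\<Phi> \<omega>) (ereal (\<Phi> \<omega> \<sigma>)))" (is "simple_function M ?t")
proof -
  let ?F = "full_simplex N"
  note [measurable] = \<Phi> \<Phi>[OF assms]
  have F: "finite ?F"
    by (rule finite_full_simplex)
  have "finite (?s ` space M)" "finite (?t ` space M)"
    by (rule finite_subset[of _ "Pow ?F"]; use F in \<open>auto simp: sublevel_real\<close>)+
  moreover have "?s -` {A} \<inter> space M \<in> sets M" if "A \<subseteq> ?F" for A
  proof -
    have "?s -` {A} \<inter> space M = {\<omega> \<in> space M. \<forall>\<tau>\<in>?F. \<Phi> \<omega> \<tau> \<le> \<Phi> \<omega> \<sigma> \<longleftrightarrow> \<tau> \<in> A}"
      using that by (auto simp: sublevel_real)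
    also have "\<dots> \<in> sets M"
      using F by measurable
    finally show ?thesis .
  qed
  moreover have "?t -` {A} \<inter> space M \<in> sets M" if "A \<subseteq> ?F" for A
  proof -
    have "?t -` {A} \<inter> space M = {\<omega> \<in> space M. \<forall>\<tau>\<in>?F. \<Phi> \<omega> \<tau> < \<Phi> \<omega> \<sigma> \<longleftrightarrow> \<tau> \<in> A}"
      using that by (auto simp: sublevel_real)
    also have "\<dots> \<in> sets M"
      using F by measurable
    finally show ?thesis .
  qed
  ultimately show "simple_function M ?s" "simple_function M ?t"
    unfolding simple_function_def by (auto simp: sublevel_real)
qed

text \<open>The multiplicity depends on the sample point only through four finitely valued
  complexes. An arbitrary function of simple functions is simple, so nothing has to be known about
  Betti numbers.\<close>

lemma borel_measurable_pair_multiplicity: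
  assumes "\<sigma> \<in> full_simplex N" "\<tau> \<in> full_simplex N"
  shows "(\<lambda>\<omega>. real (pair_multiplicity N (\<Phi> \<omega>) l (\<Phi> \<omega> \<sigma>) (ereal (\<Phi> \<omega> \<tau>)))) \<in> borel_measurable M"
proof -
  let ?h = "\<lambda>((A, A'), B, B'). real (nat (int (persistent_betti A B' l) - int (persistent_betti A B l)
     - (int (persistent_betti A' B' l) - int (persistent_betti A' B l))))"
  have "simple_function M (?h \<circ> (\<lambda>\<omega>.
     ((sublevel N (\<Phi> \<omega>) (ereal (\<Phi> \<omega> \<sigma>)), strict_sublevel N (\<Phi> \<omega>) (ereal (\<Phi> \<omega> \<sigma>))),
      (sublevel N (\<Phi> \<omega>) (ereal (\<Phi> \<omega> \<tau>)), strict_sublevel N (\<Phi> \<omega>) (ereal (\<Phi> \<omega> \<tau>))))))"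
    by (intro simple_function_compose simple_function_Pair simple_function_sublevel assms)
  then show ?thesis
    by (intro borel_measurable_simple_function) (simp add: comp_def pair_multiplicity_def dying_def)
qed

lemma borel_measurable_sum_mset_finite_lifetimes:
  "(\<lambda>\<omega>. \<Sum>\<^sub># (finite_lifetimes (persistence_diagram N (\<Phi> \<omega>) l))) \<in> borel_measurable M"
proof -
  let ?F = "full_simplex N"
  \<comment> \<open>The fibre size that serves as weight; it is itself random, and measurable as a
    finite sum of indicators.\<close>
  let ?c = "\<lambda>\<omega> \<sigma>. real (card {\<sigma>' \<in> ?F. \<Phi> \<omega> \<sigma>' = \<Phi> \<omega> \<sigma>})"
  note [measurable] = \<Phi>
  have c[measurable]: "(\<lambda>\<omega>. ?c \<omega> \<sigma>) \<in> borel_measurable M" if "\<sigma> \<in> ?F" for \<sigma>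
  proof -
    have "?c \<omega> \<sigma> = (\<Sum>\<sigma>'\<in>?F. if \<Phi> \<omega> \<sigma>' = \<Phi> \<omega> \<sigma> then 1 else 0)" for \<omega>
      using finite_full_simplex by (simp add: sum.If_cases Int_def)
    moreover have "(\<lambda>\<omega>. \<Sum>\<sigma>'\<in>?F. if \<Phi> \<omega> \<sigma>' = \<Phi> \<omega> \<sigma> then 1 else (0::real)) \<in> borel_measurable M"
      using that by measurable
    ultimately show ?thesis by simp
  qed
  have "(\<lambda>\<omega>. \<Sum>\<sigma>\<in>?F. (\<Sum>\<tau>\<in>?F. (if \<Phi> \<omega> \<sigma> < \<Phi> \<omega> \<tau> then
      real (pair_multiplicity N (\<Phi> \<omega>) l (\<Phi> \<omega> \<sigma>) (ereal (\<Phi> \<omega> \<tau>))) * (\<Phi> \<omega> \<tau> - \<Phi> \<omega> \<sigma>) else 0)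
        / ?c \<omega> \<tau>) / ?c \<omega> \<sigma>) \<in> borel_measurable M"
    by (intro borel_measurable_sum borel_measurable_divide c measurable_If borel_measurable_times
        borel_measurable_pair_multiplicity borel_measurable_diff \<Phi> borel_measurable_const borel_measurable_pred_less)
      auto
  moreover have "\<Sum>\<^sub># (finite_lifetimes (persistence_diagram N (\<Phi> \<omega>) l)) =
    (\<Sum>\<sigma>\<in>?F. (\<Sum>\<tau>\<in>?F. (if \<Phi> \<omega> \<sigma> < \<Phi> \<omega> \<tau> then
      real (pair_multiplicity N (\<Phi> \<omega>) l (\<Phi> \<omega> \<sigma>) (ereal (\<Phi> \<omega> \<tau>))) * (\<Phi> \<omega> \<tau> - \<Phi> \<omega> \<sigma>) else 0)
        / ?c \<omega> \<tau>) / ?c \<omega> \<sigma>)" for \<omega>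
  proof -
    have "\<Sum>\<^sub># (finite_lifetimes (persistence_diagram N (\<Phi> \<omega>) l)) =
      (\<Sum>b\<in>\<Phi> \<omega> ` ?F. \<Sum>d\<in>\<Phi> \<omega> ` ?F. if b < d then
         real (pair_multiplicity N (\<Phi> \<omega>) l b (ereal d)) * (d - b) else 0)"
      unfolding sum_mset_finite_lifetimes
      using finite_full_simplex by (intro sum.cong refl sum.inter_filter) simp
    also have "\<dots> = (\<Sum>b\<in>\<Phi> \<omega> ` ?F. \<Sum>\<tau>\<in>?F. (if b < \<Phi> \<omega> \<tau> then
         real (pair_multiplicity N (\<Phi> \<omega>) l b (ereal (\<Phi> \<omega> \<tau>))) * (\<Phi> \<omega> \<tau> - b) else 0) / ?c \<omega> \<tau>)"
      by (intro sum.cong refl sum_image_eq_weighted finite_full_simplex)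
    also have "\<dots> = (\<Sum>\<sigma>\<in>?F. (\<Sum>\<tau>\<in>?F. (if \<Phi> \<omega> \<sigma> < \<Phi> \<omega> \<tau> then
         real (pair_multiplicity N (\<Phi> \<omega>) l (\<Phi> \<omega> \<sigma>) (ereal (\<Phi> \<omega> \<tau>))) * (\<Phi> \<omega> \<tau> - \<Phi> \<omega> \<sigma>) else 0)
        / ?c \<omega> \<tau>) / ?c \<omega> \<sigma>)"
      by (intro sum_image_eq_weighted finite_full_simplex)
    finally show ?thesis .
  qed
  ultimately show ?thesis by simp
qed

lemma borel_measurable_Max_finite_lifetimes:
  assumes "N \<ge> 1"
  shows "(\<lambda>\<omega>. if finite_lifetimes (persistence_diagram N (\<Phi> \<omega>) l) = {#} then 0
      else Max (set_mset (finite_lifetimes (persistence_diagram N (\<Phi> \<omega>) l)))) \<in> borel_measurable M"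
proof -
  let ?F = "full_simplex N"
  let ?m = "\<lambda>\<omega> \<sigma> \<tau>. real (pair_multiplicity N (\<Phi> \<omega>) l (\<Phi> \<omega> \<sigma>) (ereal (\<Phi> \<omega> \<tau>)))"
  \<comment> \<open>The lifetime if the two values form a pair of the diagram, and 0
    otherwise.\<close>
  let ?g = "\<lambda>\<omega> (\<sigma>, \<tau>). if \<Phi> \<omega> \<sigma> < \<Phi> \<omega> \<tau> \<and> 0 < ?m \<omega> \<sigma> \<tau> then \<Phi> \<omega> \<tau> - \<Phi> \<omega> \<sigma> else 0"
  note [measurable] = \<Phi>
  have "{1..N} \<in> ?F"
    using assms by (auto simp: full_simplex_def)
  then have ne: "?F \<times> ?F \<noteq> {}" by auto
  have "(\<lambda>\<omega>. ?g \<omega> x) \<in> borel_measurable M" if x: "x \<in> ?F \<times> ?F" for x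
  proof -
    obtain \<sigma> \<tau> where [simp]: "x = (\<sigma>, \<tau>)" "\<sigma> \<in> ?F" "\<tau> \<in> ?F" using x by auto
    note [measurable] = borel_measurable_pair_multiplicity[of \<sigma> \<tau> l]
    have "(\<lambda>\<omega>. if \<Phi> \<omega> \<sigma> < \<Phi> \<omega> \<tau> \<and> 0 < ?m \<omega> \<sigma> \<tau> then \<Phi> \<omega> \<tau> - \<Phi> \<omega> \<sigma> else 0) \<in> borel_measurable M"
      by measurable
    then show ?thesis by (simp only: prod.case \<open>x = (\<sigma>, \<tau>)\<close>)
  qed
  then have "(\<lambda>\<omega>. Max (?g \<omega> ` (?F \<times> ?F))) \<in> borel_measurable M"
    using finite_full_simplex by (intro borel_measurable_Max) auto
  moreover have "Max (?g \<omega> ` (?F \<times> ?F)) = (if finite_lifetimes (persistence_diagram N (\<Phi> \<omega>) l) = {#} then 0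
      else Max (set_mset (finite_lifetimes (persistence_diagram N (\<Phi> \<omega>) l))))" for \<omega>
    unfolding set_mset_eq_empty_iff[symmetric]
  proof (rule Max_insert_0_eq)
    show "set_mset (finite_lifetimes (persistence_diagram N (\<Phi> \<omega>) l)) \<subseteq> ?g \<omega> ` (?F \<times> ?F)"
      unfolding set_mset_finite_lifetimes by (force simp: image_iff)
    show "?g \<omega> ` (?F \<times> ?F) \<subseteq> insert 0 (set_mset (finite_lifetimes (persistence_diagram N (\<Phi> \<omega>) l)))"
    proof (rule image_subsetI)
      fix x assume "x \<in> ?F \<times> ?F"
      then obtain \<sigma> \<tau> where x: "x = (\<sigma>, \<tau>)" "\<sigma> \<in> ?F" "\<tau> \<in> ?F" by auto
      show "?g \<omega> x \<in> insert 0 (set_mset (finite_lifetimes (persistence_diagram N (\<Phi> \<omega>) l)))"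
        unfolding x(1) prod.case set_mset_finite_lifetimes using x(2,3)
        by (cases "\<Phi> \<omega> \<sigma> < \<Phi> \<omega> \<tau> \<and> 0 < pair_multiplicity N (\<Phi> \<omega>) l (\<Phi> \<omega> \<sigma>) (ereal (\<Phi> \<omega> \<tau>))") auto
    qed
    show "0 \<le> y" if "y \<in># finite_lifetimes (persistence_diagram N (\<Phi> \<omega>) l)" for y
      using that unfolding set_mset_finite_lifetimes by auto
  qed (use finite_full_simplex ne in auto)
  ultimately show ?thesis by simp
qed

end

lemma borel_measurable_vietoris_rips:
  fixes X :: "nat \<Rightarrow> 'w \<Rightarrow> 'a::{real_normed_vector, second_countable_topology}"
  assumes "\<And>i. i \<in> {1..N} \<Longrightarrow> X i \<in> borel_measurable M" "\<sigma> \<in> full_simplex N"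
  shows "(\<lambda>\<omega>. vietoris_rips (\<lambda>i. X i \<omega>) \<sigma>) \<in> borel_measurable M"
proof -
  have \<sigma>: "finite \<sigma>" "\<sigma> \<subseteq> {1..N}"
    using assms(2) finite_subset by (auto simp: full_simplex_def)
  have "(\<lambda>\<omega>. norm (X i \<omega> - X j \<omega>)) \<in> borel_measurable M" if "i \<in> \<sigma>" "j \<in> \<sigma>" for i j
  proof -
    have [measurable]: "X i \<in> borel_measurable M" "X j \<in> borel_measurable M"
      using that \<sigma>(2) assms(1) by auto
    show ?thesis by measurable
  qed
  with \<sigma>(1) have "(\<lambda>\<omega>. Max ((\<lambda>(i, j). norm (X i \<omega> - X j \<omega>)) ` (\<sigma> \<times> \<sigma>))) \<in> borel_measurable M"
    by (intro borel_measurable_Max) auto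
  then show ?thesis
    by (simp add: vietoris_rips_def)
qed

lemma borel_measurable_L:
  fixes X :: "nat \<Rightarrow> 'w \<Rightarrow> 'a::{real_normed_vector, second_countable_topology}"
  assumes "\<And>i. i \<in> {1..N} \<Longrightarrow> X i \<in> borel_measurable M" "N \<ge> 1" "L \<in> {L_total N l, L_max N l}"
  shows "(\<lambda>\<omega>. L (\<lambda>i. X i \<omega>)) \<in> borel_measurable M"
proof -
  note VR = borel_measurable_vietoris_rips[of N X M, OF assms(1)]
  from assms(3) consider "L = L_total N l" | "L = L_max N l"
    by blast
  then show ?thesis
  proof cases
    case 1
    show ?thesis
      unfolding 1 L_total_def vr_diagram_def
      by (rule borel_measurable_sum_mset_finite_lifetimes) (rule VR)
  next
    case 2
    show ?thesis
      unfolding 2 L_max_def vr_diagram_def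
      by (rule borel_measurable_Max_finite_lifetimes[OF _ assms(2)]) (rule VR)
  qed
qed

section \<open>Square roots of positive semidefinite matrices\<close>

text \<open>For a semidefinite form, a null vector of the quadratic form lies in the kernel:
  otherwise moving from \<open>v\<close> a little in the direction \<open>- g v\<close> makes the
  form negative. Both the eigenvector construction and uniqueness of the root use this.\<close>

lemma semidefinite_zero:
  fixes g :: "'a::real_inner \<Rightarrow> 'a"
  assumes g: "linear g" and sym: "\<And>x y. x \<bullet> g y = g x \<bullet> y"
    and S: "subspace S" and nonneg: "\<And>x. x \<in> S \<Longrightarrow> 0 \<le> x \<bullet> g x"
    and v: "v \<in> S" "g v \<in> S" "v \<bullet> g v = 0"
  shows "g v = 0"
proof (rule ccontr)
  assume "g v \<noteq> 0"
  define a b where "a = g v \<bullet> g (g v)" and "b = g v \<bullet> g v"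
  have ab: "0 \<le> a" "0 < b"
    using nonneg v(2) \<open>g v \<noteq> 0\<close> by (auto simp: a_def b_def)
  have *: "0 \<le> 2 * t * b + t\<^sup>2 * a" for t
  proof -
    have "0 \<le> (v + t *\<^sub>R g v) \<bullet> g (v + t *\<^sub>R g v)"
      using S v by (intro nonneg) (simp add: subspace_add subspace_scale)
    also have "\<dots> = 2 * t * b + t\<^sup>2 * a"
      using v(3) sym[of v "g v"]
      by (simp add: linear_add[OF g] linear_scale[OF g] inner_add_left inner_add_right a_def b_def
          power2_eq_square algebra_simps)
    finally show ?thesis .
  qed
  \<comment> \<open>At \<open>t = - s\<close> the quadratic equals
    \<open>s\<^sup>2 * (- a - 2)\<close>. The summand 1 keeps the denominator positive when
    \<open>a = 0\<close>.\<close>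
  define s where "s = b / (a + 1)"
  have "b = s * (a + 1)" "0 < s"
    using ab by (simp_all add: s_def)
  then have "2 * (- s) * b + (- s)\<^sup>2 * a = s\<^sup>2 * (- a - 2)"
    by (simp add: algebra_simps power2_eq_square)
  moreover have "s\<^sup>2 * (- a - 2) < 0"
    using ab \<open>0 < s\<close> by (intro mult_pos_neg) auto
  moreover have "0 \<le> 2 * (- s) * b + (- s)\<^sup>2 * a"
    by (rule *)
  ultimately show False by linarith
qed

text \<open>A maximiser \<open>v\<close> of the Rayleigh quotient on the unit sphere of
  \<open>S\<close> works: with \<open>c\<close> the maximum, the operator \<open>c - f\<close> is
  semidefinite on \<open>S\<close> and its form vanishes at \<open>v\<close>.\<close>

lemma self_adjoint_eigenvector:
  fixes f :: "'a::euclidean_space \<Rightarrow> 'a"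
  assumes f: "linear f" and sym: "\<And>x y. x \<bullet> f y = f x \<bullet> y"
    and S: "subspace S" "S \<noteq> {0}" and inv: "\<And>x. x \<in> S \<Longrightarrow> f x \<in> S"
  obtains v c where "v \<in> S" "norm v = 1" "f v = c *\<^sub>R v"
proof -
  obtain w where w: "w \<in> S" "w \<noteq> 0"
    using S subspace_0 by blast
  then have "(1 / norm w) *\<^sub>R w \<in> sphere 0 1 \<inter> S"
    using S by (auto intro: subspace_scale)
  then have ne: "sphere 0 1 \<inter> S \<noteq> {}" by blast
  have "compact (sphere 0 1 \<inter> S)"
    using S(1) by (intro compact_Int_closed closed_subspace) auto
  moreover have "continuous_on (sphere 0 1 \<inter> S) (\<lambda>x. x \<bullet> f x)"
    using f by (intro continuous_intros linear_continuous_on) (simp add: linear_conv_bounded_linear)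
  ultimately obtain v where v: "v \<in> sphere 0 1 \<inter> S"
    and max: "\<And>x. x \<in> sphere 0 1 \<inter> S \<Longrightarrow> x \<bullet> f x \<le> v \<bullet> f v"
    using continuous_attains_sup[OF _ ne] by blast
  define c where "c = v \<bullet> f v"
  define g where "g x = c *\<^sub>R x - f x" for x
  have nv: "norm v = 1" "v \<in> S" using v by auto
  have "g v = 0"
  proof (rule semidefinite_zero[of g S])
    show "linear g"
      unfolding g_def using f by (intro linear_compose_sub linear_scaleR)
    show "x \<bullet> g y = g x \<bullet> y" for x y
      by (simp add: g_def inner_diff_left inner_diff_right sym)
    show "0 \<le> x \<bullet> g x" if "x \<in> S" for x
    proof (cases "x = 0")
      case False
      let ?u = "(1 / norm x) *\<^sub>R x"
      have "?u \<in> sphere 0 1 \<inter> S"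
        using S that False by (auto intro: subspace_scale)
      from max[OF this] have "x \<bullet> f x / (norm x)\<^sup>2 \<le> c"
        using f by (simp add: c_def linear_scale power2_eq_square)
      then have "x \<bullet> f x \<le> c * (norm x)\<^sup>2"
        using False by (simp add: field_simps)
      then show ?thesis
        by (simp add: g_def inner_diff_right power2_norm_eq_inner)
    qed simp
    show "v \<bullet> g v = 0"
      using nv by (simp add: g_def inner_diff_right c_def power2_norm_eq_inner[symmetric])
    show "g v \<in> S"
      using nv inv S by (simp add: g_def subspace_diff subspace_scale)
  qed (use S nv in auto)
  then show ?thesis
    using nv that[of v c] by (simp add: g_def)
qed

text \<open>Spectral induction: split off an eigenvector and recurse on its orthogonal complement in
  \<open>S\<close>. Demanding \<open>g x \<in> S\<close> for every \<open>x\<close> of the whole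
  space strengthens the induction, as it forces the smaller root to have range orthogonal to
  \<open>v\<close>.\<close>

lemma positive_operator_sqrt_on:
  fixes f :: "'a::euclidean_space \<Rightarrow> 'a"
  assumes f: "linear f" and sym: "\<And>x y. x \<bullet> f y = f x \<bullet> y" and pos: "\<And>x. 0 \<le> x \<bullet> f x"
    and S: "subspace S" and inv: "\<And>x. x \<in> S \<Longrightarrow> f x \<in> S"
  shows "\<exists>g. linear g \<and> (\<forall>x y. x \<bullet> g y = g x \<bullet> y) \<and> (\<forall>x. 0 \<le> x \<bullet> g x) \<and>
    (\<forall>x. g x \<in> S) \<and> (\<forall>x\<in>S. g (g x) = f x)"
  using S inv
proof (induction "dim S" arbitrary: S rule: less_induct)
  case less
  show ?case
  proof (cases "S = {0}")
    case True
    then show ?thesis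
      using linear_0[OF f] by (intro exI[of _ "\<lambda>_. 0"]) (auto simp: linear_zero)
  next
    case False
    obtain v c where v: "v \<in> S" "norm v = 1" "f v = c *\<^sub>R v"
      using self_adjoint_eigenvector[OF f sym less.prems(1) False less.prems(2)] by metis
    have vv: "v \<bullet> v = 1"
      using v(2) by (simp add: power2_norm_eq_inner[symmetric])
    have c: "0 \<le> c"
      using pos[of v] v(3) vv by simp
    define T where "T = S \<inter> {x. v \<bullet> x = 0}"
    have T: "subspace T"
      unfolding T_def by (intro subspace_inter less.prems subspace_hyperplane)
    have "f x \<in> T" if "x \<in> T" for x
      using that less.prems(2) by (simp add: T_def sym v(3))
    moreover have "dim T < dim S"
    proof (rule dim_psubset)
      have "v \<notin> T" using vv by (simp add: T_def)
      then have "T \<noteq> S" using v(1) by blast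
      then have "T \<subset> S" using T_def by blast
      then show "span T \<subset> span S"
        using T less.prems(1) by (metis span_eq_iff)
    qed
    ultimately obtain g where g: "linear g" "\<And>x y. x \<bullet> g y = g x \<bullet> y" "\<And>x. 0 \<le> x \<bullet> g x"
      "\<And>x. g x \<in> T" "\<And>x. x \<in> T \<Longrightarrow> g (g x) = f x"
      using less.hyps[of T] T by blast
    have vg: "v \<bullet> g x = 0" for x
      using g(4)[of x] by (simp add: T_def)
    \<comment> \<open>By symmetry \<open>g v \<bullet> g v\<close> equals
      \<open>v \<bullet> g (g v)\<close>, and the range of \<open>g\<close> is orthogonal to
      \<open>v\<close>.\<close>
    have gv: "g v = 0"
      using g(2)[of v "g v"] vg[of "g v"] by simp
    \<comment> \<open>The smaller root plus \<open>sqrt c\<close> times the orthogonal projection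
      onto the line of \<open>v\<close>. The cross terms in \<open>h (h x)\<close> vanish by
      \<open>vg\<close> and \<open>gv\<close>.\<close>
    define h where "h x = g x + (sqrt c * (v \<bullet> x)) *\<^sub>R v" for x
    have "linear (\<lambda>x. (sqrt c * (v \<bullet> x)) *\<^sub>R v)"
      by (rule linearI) (simp_all only: inner_add_right inner_scaleR_right distrib_left
          scaleR_add_left scaleR_scaleR mult.left_commute)
    then have "linear h"
      unfolding h_def by (rule linear_compose_add[OF g(1)])
    moreover have "x \<bullet> h y = h x \<bullet> y" for x y
      using g(2)[of x y] by (simp add: h_def inner_add_left inner_add_right inner_commute[of x v])
    moreover have "0 \<le> x \<bullet> h x" for x
    proof -
      have "x \<bullet> h x = x \<bullet> g x + sqrt c * (v \<bullet> x)\<^sup>2"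
        by (simp add: h_def inner_add_right inner_commute[of x v] power2_eq_square)
      then show ?thesis
        using g(3)[of x] c by simp
    qed
    moreover have "h x \<in> S" for x
      using g(4)[of x] v(1) less.prems(1) by (simp add: h_def T_def subspace_add subspace_scale)
    moreover have "h (h x) = f x" if "x \<in> S" for x
    proof -
      define y where "y = x - (v \<bullet> x) *\<^sub>R v"
      have "y \<in> T"
        using that v(1) vv less.prems(1)
        by (simp add: y_def T_def subspace_diff subspace_scale inner_diff_right)
      have x: "x = y + (v \<bullet> x) *\<^sub>R v"
        by (simp add: y_def)
      have gx: "g x = g y"
        by (subst x) (simp add: linear_add[OF g(1)] linear_scale[OF g(1)] gv)
      have "h (h x) = g (g y) + (c * (v \<bullet> x)) *\<^sub>R v"
        using c by (simp add: h_def linear_add[OF g(1)] linear_scale[OF g(1)] gv gx inner_add_right vg vv)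
      also have "\<dots> = f y + (v \<bullet> x) *\<^sub>R f v"
        using g(5)[OF \<open>y \<in> T\<close>] v(3) by (simp add: mult.commute)
      also have "\<dots> = f x"
        using arg_cong[OF x, of f] by (simp only: linear_add[OF f] linear_scale[OF f])
      finally show ?thesis .
    qed
    ultimately show ?thesis by blast
  qed
qed

lemma matrix_mult_distribs:
  fixes A A' :: "real ^ 'm ^ 'n" and B B' :: "real ^ 'k ^ 'm"
  shows "(A + A') ** B = A ** B + A' ** B" "(A - A') ** B = A ** B - A' ** B"
    "A ** (B + B') = A ** B + A ** B'" "A ** (B - B') = A ** B - A ** B'"
    "(- A) ** B = - (A ** B)"
  by (simp_all add: matrix_matrix_mult_def vec_eq_iff distrib_left distrib_right left_diff_distrib right_diff_distrib sum.distrib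
    sum_subtractf sum_negf)

lemma symmetric_matrix_inner:
  "transpose A = A \<Longrightarrow> x \<bullet> (A *v y) = (A *v x) \<bullet> (y :: real ^ 'n)"
  by (metis dot_lmul_matrix transpose_matrix_vector)

lemma psd_sqrt_exists:
  assumes "psd (A :: real ^ 'n ^ 'n)"
  shows "\<exists>B. psd B \<and> B ** B = A"
proof -
  have "\<exists>g. linear g \<and> (\<forall>x y. x \<bullet> g y = g x \<bullet> y) \<and> (\<forall>x. 0 \<le> x \<bullet> g x) \<and>
    (\<forall>x. g x \<in> UNIV) \<and> (\<forall>x\<in>UNIV. g (g x) = A *v x)"
    using assms by (intro positive_operator_sqrt_on) (auto simp: psd_def symmetric_matrix_inner)
  then obtain g where g: "linear g" "\<And>x y. x \<bullet> g y = g x \<bullet> y" "\<And>x. 0 \<le> x \<bullet> g x"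
    "\<And>x. g (g x) = A *v x"
    by auto
  have m: "matrix g *v x = g x" for x
    using g(1) by simp
  have "transpose (matrix g) = matrix g"
    using g(2) by (auto simp: vec_eq_iff matrix_def transpose_def inner_axis' inner_axis
        dest: spec[of _ "axis _ 1"]) (metis inner_axis inner_axis' inner_real_def mult.right_neutral mult_1)
  then have "psd (matrix g)"
    using g(3) m by (simp add: psd_def)
  moreover have "matrix g ** matrix g = A"
    by (subst matrix_eq) (simp add: matrix_vector_mul_assoc[symmetric] m g(4))
  ultimately show ?thesis by blast
qed

lemma inner_axis_matrix: "axis i 1 \<bullet> (A *v axis j 1) = (A :: real ^ 'n ^ 'n) $ i $ j"
  by (simp add: inner_axis' matrix_vector_mul_component inner_axis)

lemma psd_eq_0:
  assumes "psd A" "x \<bullet> (A *v x) = 0"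
  shows "A *v x = 0"
  by (rule semidefinite_zero[of "(*v) A" UNIV]) (use assms in \<open>auto simp: psd_def symmetric_matrix_inner\<close>)

text \<open>With \<open>D = B - C\<close> and \<open>S = B + C\<close>, equality of the squares gives \<open>S D = - D S\<close>, so the trace of
  the positive semidefinite matrix \<open>D S D\<close> is \<open>0\<close>.\<close>

lemma psd_sqrt_unique:
  assumes B: "psd (B :: real ^ 'n ^ 'n)" and C: "psd C" and eq: "B ** B = C ** C"
  shows "B = C"
proof -
  define D where "D = B - C"
  have symD: "transpose D = D"
    using B C by (simp add: D_def psd_def transpose_def vec_eq_iff)
  have SD: "(B + C) ** D = - (D ** (B + C))"
    using eq by (simp add: D_def matrix_mult_distribs)
  have "trace (D ** ((B + C) ** D)) = trace (((B + C) ** D) ** D)"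
    by (rule trace_mul_sym)
  also have "((B + C) ** D) ** D = - (D ** ((B + C) ** D))"
    by (subst SD) (simp only: matrix_mult_distribs(5) matrix_mul_assoc)
  also have "trace \<dots> = - trace (D ** ((B + C) ** D))"
    by (simp add: trace_def sum_negf)
  finally have tr: "trace (D ** ((B + C) ** D)) = 0"
    by simp
  let ?d = "\<lambda>i. D *v axis i 1"
  have diag: "(D ** ((B + C) ** D)) $ i $ i = ?d i \<bullet> (B *v ?d i) + ?d i \<bullet> (C *v ?d i)" for i
    unfolding inner_axis_matrix[symmetric]
    by (simp add: matrix_vector_mul_assoc[symmetric] symmetric_matrix_inner[OF symD]
        matrix_vector_mult_add_rdistrib inner_add_right)
  have nn: "0 \<le> ?d i \<bullet> (B *v ?d i)" "0 \<le> ?d i \<bullet> (C *v ?d i)" for i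
    using B C by (auto simp: psd_def)
  have "(D ** ((B + C) ** D)) $ i $ i = 0" for i
    using tr nn unfolding trace_def diag
    by (subst (asm) sum_nonneg_eq_0_iff) (auto intro: add_nonneg_nonneg)
  then have "?d i \<bullet> (B *v ?d i) = 0" "?d i \<bullet> (C *v ?d i) = 0" for i
    using nn[of i] unfolding diag by (metis add_nonneg_eq_0_iff)+
  then have "B *v ?d i = 0" "C *v ?d i = 0" for i
    using psd_eq_0 B C by blast+
  then have "D *v ?d i = 0" for i
    by (simp add: D_def matrix_vector_mult_diff_rdistrib)
  then have "?d i = 0" for i
    using symmetric_matrix_inner[OF symD, of "axis i 1" "?d i"] by simp
  then have "D $ i $ j = 0" for i j
    using inner_axis_matrix[of i D j] by simp
  then show ?thesis
    by (simp add: D_def vec_eq_iff)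
qed

lemma psd_sqrt:
  assumes "psd A"
  shows "psd (psd_sqrt A)" "psd_sqrt A ** psd_sqrt A = A"
proof -
  have "\<exists>!B. psd B \<and> B ** B = A"
    using psd_sqrt_exists[OF assms] psd_sqrt_unique by blast
  from theI'[OF this] show "psd (psd_sqrt A)" "psd_sqrt A ** psd_sqrt A = A"
    by (auto simp: psd_sqrt_def)
qed

text \<open>The Frobenius norm bounds the operator norm, by Cauchy-Schwarz in each row; symmetry
  turns its square into \<open>trace (B ** B)\<close>. For the root of \<Sigma> this is
  \<open>trace \<Sigma>\<close>, the quantity in the constant.\<close>

lemma norm_matrix_vector_le_trace:
  fixes B :: "real ^ 'n ^ 'n"
  assumes "transpose B = B"
  shows "norm (B *v z) \<le> sqrt (trace (B ** B)) * norm z"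
proof -
  have "trace (B ** B) = (\<Sum>i\<in>UNIV. (norm (B $ i))\<^sup>2)"
  proof -
    have "B $ j $ i = B $ i $ j" for i j
      using assms by (metis transpose_def vec_lambda_beta)
    then show ?thesis
      by (simp add: trace_def matrix_matrix_mult_def power2_norm_eq_inner inner_vec_def)
  qed
  moreover have "(norm (B *v z))\<^sup>2 \<le> (\<Sum>i\<in>UNIV. (norm (B $ i))\<^sup>2 * (norm z)\<^sup>2)"
  proof -
    have "(norm (B *v z))\<^sup>2 = (\<Sum>i\<in>UNIV. (B $ i \<bullet> z)\<^sup>2)"
      unfolding power2_norm_eq_inner inner_vec_def[of "B *v z"]
      by (simp add: matrix_vector_mul_component power2_eq_square)
    also have "\<dots> \<le> (\<Sum>i\<in>UNIV. (norm (B $ i))\<^sup>2 * (norm z)\<^sup>2)"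
      by (intro sum_mono) (metis Cauchy_Schwarz_ineq power2_norm_eq_inner)
    finally show ?thesis .
  qed
  ultimately have "(norm (B *v z))\<^sup>2 \<le> trace (B ** B) * (norm z)\<^sup>2"
    by (simp add: sum_distrib_right)
  then have "norm (B *v z) \<le> sqrt (trace (B ** B) * (norm z)\<^sup>2)"
    by (rule real_le_rsqrt)
  then show ?thesis
    by (simp add: real_sqrt_mult)
qed

lemma norm_psd_sqrt_le:
  assumes "psd \<Sigma>"
  shows "norm (psd_sqrt \<Sigma> *v z) \<le> sqrt (trace \<Sigma>) * norm z"
  using norm_matrix_vector_le_trace[of "psd_sqrt \<Sigma>" z] psd_sqrt[OF assms] by (simp add: psd_def)

lemma trace_psd_nonneg:
  assumes "psd \<Sigma>"
  shows "0 \<le> trace \<Sigma>"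
  unfolding trace_def
proof (rule sum_nonneg)
  fix i
  show "0 \<le> \<Sigma> $ i $ i"
    using assms inner_axis_matrix[of i \<Sigma> i] unfolding psd_def by metis
qed

lemma psd_scale: "psd \<Sigma> \<Longrightarrow> 0 \<le> \<eta> \<Longrightarrow> psd (\<eta> *\<^sub>R \<Sigma>)"
  by (auto simp: psd_def transpose_scalar scaleR_matrix_vector_assoc[symmetric])

lemma trace_scale: "trace (\<eta> *\<^sub>R \<Sigma>) = \<eta> * trace (\<Sigma> :: real ^ 'n ^ 'n)"
  by (simp add: trace_def sum_distrib_left)

section \<open>Moments of Gaussian mixtures\<close>

lemma Basis_real_vec: "(Basis :: (real ^ 'd) set) = range (\<lambda>i. axis i 1)"
  by (auto simp: Basis_vec_def)

lemma nn_integral_lborel_vec_prod: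
  fixes f :: "real \<Rightarrow> real"
  assumes [measurable]: "f \<in> borel_measurable borel" and nonneg: "\<And>x. 0 \<le> f x"
  shows "(\<integral>\<^sup>+z. ennreal (\<Prod>i\<in>UNIV. f ((z :: real ^ 'd) $ i)) \<partial>lborel) =
    (\<integral>\<^sup>+x. ennreal (f x) \<partial>lborel) ^ CARD('d)"
proof -
  have inj: "inj (\<lambda>i::'d. axis i (1::real))"
    by (rule injI) (simp add: axis_eq_axis)
  have "(\<Prod>i\<in>UNIV. f (z $ i)) = (\<Prod>b\<in>Basis. f (z \<bullet> b))" for z :: "real ^ 'd"
    unfolding Basis_real_vec by (subst prod.reindex[OF inj]) (simp add: inner_axis)
  then have "(\<integral>\<^sup>+z. ennreal (\<Prod>i\<in>UNIV. f ((z :: real ^ 'd) $ i)) \<partial>lborel) =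
      (\<integral>\<^sup>+z. (\<Prod>b\<in>Basis. ennreal (f ((z :: real ^ 'd) \<bullet> b))) \<partial>lborel)"
    using nonneg by (simp add: prod_ennreal)
  also have "\<dots> = (\<Prod>b\<in>(Basis :: (real ^ 'd) set). \<integral>\<^sup>+x. ennreal (f x) \<partial>lborel)"
    by (rule nn_integral_lborel_prod) simp_all
  also have "\<dots> = (\<integral>\<^sup>+x. ennreal (f x) \<partial>lborel) ^ CARD('d)"
    by (simp add: Basis_real_vec card_image inj)
  finally show ?thesis .
qed

lemma nn_integral_normal_density:
  assumes "0 < \<sigma>"
  shows "(\<integral>\<^sup>+x. ennreal (normal_density m \<sigma> x) \<partial>lborel) = 1"
proof -
  interpret prob_space "density lborel (normal_density m \<sigma>)"
    by (rule prob_space_normal_density[OF assms])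
  show ?thesis
    using emeasure_space_1 by (simp add: emeasure_density)
qed

lemma borel_measurable_gaussian_prod [measurable]:
  "(\<lambda>z :: real ^ 'd. \<Prod>i\<in>UNIV. std_normal_density (z $ i)) \<in> borel_measurable borel"
  by (intro borel_measurable_prod) simp

lemma sets_std_gaussian [measurable_cong, simp]: "sets std_gaussian = sets borel"
  by (simp add: std_gaussian_def)

lemma space_std_gaussian [simp]: "space std_gaussian = UNIV"
  by (simp add: std_gaussian_def)

lemma emeasure_std_gaussian_UNIV: "emeasure (std_gaussian :: (real ^ 'd) measure) UNIV = 1"
proof -
  have "emeasure (std_gaussian :: (real ^ 'd) measure) UNIV =
      (\<integral>\<^sup>+z. ennreal (\<Prod>i\<in>UNIV. std_normal_density ((z :: real ^ 'd) $ i)) \<partial>lborel)"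
    by (simp add: std_gaussian_def emeasure_density)
  also have "\<dots> = 1"
    by (subst nn_integral_lborel_vec_prod) (simp_all add: nn_integral_normal_density)
  finally show ?thesis .
qed

text \<open>Multiplying by the exponential only widens the variance from 1 to 2, at the cost of the
  factor \<open>sqrt 2\<close>. The weight \<open>exp ((norm z)\<^sup>2 / 4)\<close> factors over
  coordinates and is therefore integrable.\<close>

lemma std_normal_density_mult_exp:
  "std_normal_density x * exp (x\<^sup>2 / 4) = sqrt 2 * normal_density 0 (sqrt 2) x"
proof -
  have "std_normal_density x * exp (x\<^sup>2 / 4) = 1 / sqrt (2 * pi) * exp (- x\<^sup>2 / 4)"
    by (simp add: normal_density_def exp_add[symmetric] field_simps)
  also have "1 / sqrt (2 * pi) = sqrt 2 * (1 / sqrt (2 * pi * (sqrt 2)\<^sup>2))"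
    using real_sqrt_mult_self[of 2] by (simp add: real_sqrt_mult field_simps)
  finally show ?thesis
    by (simp add: normal_density_def)
qed

text \<open>From \<open>r \<le> exp r\<close> and \<open>p * r \<le> p\<^sup>2 + r\<^sup>2 / 4\<close>.\<close>

lemma powr_le_exp_square:
  fixes r p :: real
  assumes "0 \<le> r" "0 \<le> p"
  shows "r powr p \<le> exp (p\<^sup>2) * exp (r\<^sup>2 / 4)"
proof -
  have "r \<le> exp r"
    using exp_ge_add_one_self[of r] by linarith
  then have "r powr p \<le> exp r powr p"
    using assms by (intro powr_mono2)
  also have "\<dots> = exp (p * r)"
    by (simp add: powr_def)
  also have "p * r \<le> p\<^sup>2 + r\<^sup>2 / 4"
    using zero_le_power2[of "r / 2 - p"] by (simp add: power2_diff power_divide algebra_simps)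
  finally show ?thesis
    by (simp add: exp_add[symmetric])
qed

text \<open>Only finiteness matters here: it identifies the nonnegative integral with
  \<open>kappa\<close>, since a Bochner integral would default to 0 without integrability.\<close>

lemma nn_integral_norm_std_gaussian_finite:
  assumes "0 \<le> p"
  shows "(\<integral>\<^sup>+z. ennreal (norm (z :: real ^ 'd) powr p) \<partial>std_gaussian) < \<infinity>"
proof -
  let ?f = "\<lambda>x. sqrt 2 * normal_density 0 (sqrt 2) x"
  let ?g = "\<lambda>z :: real ^ 'd. \<Prod>i\<in>UNIV. std_normal_density (z $ i)"
  have "(\<integral>\<^sup>+z. ennreal (norm (z :: real ^ 'd) powr p) \<partial>std_gaussian) =
      (\<integral>\<^sup>+z. ennreal (?g z) * ennreal (norm z powr p) \<partial>lborel)"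
    unfolding std_gaussian_def by (intro nn_integral_density) simp_all
  also have "\<dots> \<le> (\<integral>\<^sup>+z. ennreal (exp (p\<^sup>2)) * ennreal (\<Prod>i\<in>UNIV. ?f ((z :: real ^ 'd) $ i)) \<partial>lborel)"
  proof (rule nn_integral_mono)
    fix z :: "real ^ 'd"
    have "?g z * norm z powr p \<le> ?g z * (exp (p\<^sup>2) * exp ((norm z)\<^sup>2 / 4))"
      using assms by (intro mult_left_mono powr_le_exp_square prod_nonneg) auto
    also have "exp ((norm z)\<^sup>2 / 4) = (\<Prod>i\<in>UNIV. exp ((z $ i)\<^sup>2 / 4))"
      unfolding power2_norm_eq_inner inner_vec_def exp_sum[OF finite, symmetric] sum_divide_distrib[symmetric]
      by (simp add: power2_eq_square)
    also have "?g z * (exp (p\<^sup>2) * \<dots>) = exp (p\<^sup>2) * (\<Prod>i\<in>UNIV. ?f (z $ i))"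
      unfolding std_normal_density_mult_exp[symmetric] prod.distrib by simp
    finally show "ennreal (?g z) * ennreal (norm z powr p) \<le> ennreal (exp (p\<^sup>2)) * ennreal (\<Prod>i\<in>UNIV. ?f (z $ i))"
      by (subst (1 2) ennreal_mult[symmetric]) (auto intro!: prod_nonneg ennreal_leI)
  qed
  also have "\<dots> = ennreal (exp (p\<^sup>2)) * (\<integral>\<^sup>+x. ennreal (?f x) \<partial>lborel) ^ CARD('d)"
  proof -
    have "(\<lambda>z :: real ^ 'd. \<Prod>i\<in>UNIV. ?f (z $ i)) \<in> borel_measurable borel"
      by (intro borel_measurable_prod) simp
    then have "(\<integral>\<^sup>+z. ennreal (exp (p\<^sup>2)) * ennreal (\<Prod>i\<in>UNIV. ?f ((z :: real ^ 'd) $ i)) \<partial>lborel) =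
        ennreal (exp (p\<^sup>2)) * (\<integral>\<^sup>+z. ennreal (\<Prod>i\<in>UNIV. ?f ((z :: real ^ 'd) $ i)) \<partial>lborel)"
      by (intro nn_integral_cmult) simp
    also have "(\<integral>\<^sup>+z. ennreal (\<Prod>i\<in>UNIV. ?f ((z :: real ^ 'd) $ i)) \<partial>lborel) =
        (\<integral>\<^sup>+x. ennreal (?f x) \<partial>lborel) ^ CARD('d)"
      by (rule nn_integral_lborel_vec_prod) simp_all
    finally show ?thesis .
  qed
  also have "(\<integral>\<^sup>+x. ennreal (?f x) \<partial>lborel) = ennreal (sqrt 2)"
    by (simp add: ennreal_mult nn_integral_cmult nn_integral_normal_density)
  also have "ennreal (exp (p\<^sup>2)) * ennreal (sqrt 2) ^ CARD('d) < \<infinity>"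
    by (simp add: ennreal_mult_less_top ennreal_power)
  finally show ?thesis .
qed

lemma nn_integral_norm_std_gaussian:
  assumes "0 \<le> p"
  shows "(\<integral>\<^sup>+z. ennreal (norm (z :: real ^ 'd) powr p) \<partial>std_gaussian) = ennreal (kappa TYPE('d) p)"
  unfolding kappa_def
  using nn_integral_norm_std_gaussian_finite[OF assms]
  by (intro nn_integral_eq_integral integrableI_nonneg) auto

lemma kappa_nonneg: "0 \<le> kappa TYPE('d::finite) p"
  unfolding kappa_def by (rule integral_nonneg_AE) simp

section \<open>Gaussian laws and their mixtures\<close>

lemma sets_gaussian [measurable_cong, simp]: "sets (gaussian m \<Sigma>) = sets borel"
  by (simp add: gaussian_def)

lemma nn_integral_norm_gaussian_le:
  fixes m :: "real ^ 'd"
  assumes "1 \<le> p" "psd \<Sigma>"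
  shows "(\<integral>\<^sup>+y. ennreal (norm y powr p) \<partial>gaussian m \<Sigma>) \<le>
    ennreal (2 powr (p - 1) * (norm m powr p + trace \<Sigma> powr (p / 2) * kappa TYPE('d) p))"
proof -
  let ?B = "psd_sqrt \<Sigma>"
  have [measurable]: "(\<lambda>z. m + ?B *v z) \<in> borel_measurable borel"
    by (intro borel_measurable_continuous_onI continuous_intros)
  have "(\<integral>\<^sup>+y. ennreal (norm y powr p) \<partial>gaussian m \<Sigma>) =
      (\<integral>\<^sup>+z. ennreal (norm (m + ?B *v z) powr p) \<partial>std_gaussian)"
    unfolding gaussian_def by (intro nn_integral_distr) simp_all
  also have "\<dots> \<le> (\<integral>\<^sup>+z. ennreal (2 powr (p - 1) * norm m powr p) +
      ennreal (2 powr (p - 1) * trace \<Sigma> powr (p / 2)) * ennreal (norm (z :: real ^ 'd) powr p) \<partial>std_gaussian)"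
  proof (rule nn_integral_mono)
    fix z
    have "norm (?B *v z) powr p \<le> (sqrt (trace \<Sigma>) * norm z) powr p"
      using assms by (intro powr_mono2 norm_psd_sqrt_le) auto
    also have "\<dots> = trace \<Sigma> powr (p / 2) * norm z powr p"
      using trace_psd_nonneg[OF assms(2)] by (simp add: powr_mult powr_half_sqrt[symmetric] powr_powr)
    finally have *: "norm (?B *v z) powr p \<le> trace \<Sigma> powr (p / 2) * norm z powr p" .
    have "norm (m + ?B *v z) powr p \<le> (norm m + norm (?B *v z)) powr p"
      using assms by (intro powr_mono2 norm_triangle_ineq) auto
    also have "\<dots> \<le> 2 powr (p - 1) * (norm m powr p + norm (?B *v z) powr p)"
      using assms by (intro powr_sum_le) auto
    also have "\<dots> \<le> 2 powr (p - 1) * (norm m powr p + trace \<Sigma> powr (p / 2) * norm z powr p)"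
      using * by (intro mult_left_mono) auto
    finally show "ennreal (norm (m + ?B *v z) powr p) \<le> ennreal (2 powr (p - 1) * norm m powr p) +
      ennreal (2 powr (p - 1) * trace \<Sigma> powr (p / 2)) * ennreal (norm z powr p)"
      by (simp add: ennreal_mult[symmetric] ennreal_plus[symmetric] algebra_simps del: ennreal_plus)
  qed
  also have "\<dots> = ennreal (2 powr (p - 1) * norm m powr p) +
      ennreal (2 powr (p - 1) * trace \<Sigma> powr (p / 2)) * ennreal (kappa TYPE('d) p)"
    using assms(1) by (subst nn_integral_add; simp add: nn_integral_cmult nn_integral_norm_std_gaussian
        emeasure_std_gaussian_UNIV)
  also have "\<dots> = ennreal (2 powr (p - 1) * (norm m powr p + trace \<Sigma> powr (p / 2) * kappa TYPE('d) p))"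
    using kappa_nonneg[of p, where 'd='d]
    by (simp add: ennreal_mult[symmetric] ennreal_plus[symmetric] algebra_simps del: ennreal_plus)
  finally show ?thesis .
qed

lemma sets_gaussian_mixture [measurable_cong, simp]: "sets (gaussian_mixture K w \<mu> \<Sigma>) = sets borel"
  unfolding gaussian_mixture_def by (simp add: sets.sigma_sets_eq[of borel, simplified])

text \<open>\<open>measure_of\<close> falls back to the zero measure unless the given set function
  is a measure, so countable additivity has to be checked.\<close>

lemma emeasure_gaussian_mixture:
  fixes \<mu> :: "nat \<Rightarrow> real ^ 'd"
  assumes "A \<in> sets borel"
  shows "emeasure (gaussian_mixture K w \<mu> \<Sigma>) A =
    (\<Sum>k=1..K. ennreal (w k) * emeasure (gaussian (\<mu> k) (\<Sigma> k)) A)"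
proof (rule emeasure_measure_of[OF gaussian_mixture_def])
  let ?m = "\<lambda>A. \<Sum>k=1..K. ennreal (w k) * emeasure (gaussian (\<mu> k) (\<Sigma> k)) A"
  show "positive (sets (gaussian_mixture K w \<mu> \<Sigma>)) ?m"
    by (simp add: positive_def)
  show "countably_additive (sets (gaussian_mixture K w \<mu> \<Sigma>)) ?m"
  proof (rule countably_additiveI)
    fix A :: "nat \<Rightarrow> (real ^ 'd) set"
    assume A: "range A \<subseteq> sets (gaussian_mixture K w \<mu> \<Sigma>)" "disjoint_family A"
    have "suminf (\<lambda>i. ?m (A i)) =
        (\<Sum>k=1..K. suminf (\<lambda>i. ennreal (w k) * emeasure (gaussian (\<mu> k) (\<Sigma> k)) (A i)))"
      by (rule suminf_sum) simp
    also have "\<dots> = ?m (\<Union>i. A i)"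
      using A by (simp add: suminf_emeasure)
    finally show "suminf (\<lambda>i. ?m (A i)) = ?m (\<Union>i. A i)" .
  qed
qed (use assms in auto)

lemma nn_integral_gaussian_mixture:
  fixes \<mu> :: "nat \<Rightarrow> real ^ 'd"
  assumes "f \<in> borel_measurable borel"
  shows "(\<integral>\<^sup>+y. f y \<partial>gaussian_mixture K w \<mu> \<Sigma>) =
    (\<Sum>k=1..K. ennreal (w k) * (\<integral>\<^sup>+y. f y \<partial>gaussian (\<mu> k) (\<Sigma> k)))"
  using assms
proof (induction f rule: borel_measurable_induct)
  case (cong f g)
  then show ?case by (metis (no_types, lifting) ext space_borel UNIV_I)
next
  case (set A)
  then show ?case by (simp add: emeasure_gaussian_mixture)
next
  case (mult u c)
  then show ?case
    by (simp add: nn_integral_cmult sum_distrib_left mult.left_commute)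
next
  case (add u v)
  then show ?case
    by (simp add: nn_integral_add sum.distrib distrib_left)
next
  case (seq U)
  have inc: "incseq (\<lambda>i. \<integral>\<^sup>+y. U i y \<partial>N)" for N
    using seq.hyps by (auto simp: incseq_def le_fun_def intro!: nn_integral_mono)
  have SUP: "(\<integral>\<^sup>+y. (SUP i. U i) y \<partial>N) = (SUP i. \<integral>\<^sup>+y. U i y \<partial>N)"
    if "sets N = sets borel" for N
    unfolding SUP_apply using seq.hyps that
    by (intro nn_integral_monotone_convergence_SUP) (simp_all cong: measurable_cong_sets)
  have "(\<integral>\<^sup>+y. (SUP i. U i) y \<partial>gaussian_mixture K w \<mu> \<Sigma>) =
      (SUP i. \<Sum>k=1..K. ennreal (w k) * (\<integral>\<^sup>+y. U i y \<partial>gaussian (\<mu> k) (\<Sigma> k)))"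
    by (simp only: SUP[OF sets_gaussian_mixture] seq.IH)
  also have "\<dots> = (\<Sum>k=1..K. SUP i. ennreal (w k) * (\<integral>\<^sup>+y. U i y \<partial>gaussian (\<mu> k) (\<Sigma> k)))"
    \<comment> \<open>Supremum and finite sum commute because each component integral is increasing
      in \<open>i\<close>.\<close>
    using inc by (intro ennreal_SUP_sum) (auto simp: incseq_def intro!: mult_left_mono)
  also have "\<dots> = (\<Sum>k=1..K. ennreal (w k) * (\<integral>\<^sup>+y. (SUP i. U i) y \<partial>gaussian (\<mu> k) (\<Sigma> k)))"
    by (simp only: SUP[OF sets_gaussian] SUP_mult_left_ennreal)
  finally show ?case .
qed

text \<open>The scale enters only through the covariance, so \<open>\<eta> powr (p / 2)\<close>
  multiplies the trace part and leaves the part of the means untouched.\<close>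

lemma nn_integral_norm_gaussian_mixture_le:
  fixes \<mu> :: "nat \<Rightarrow> real ^ 'd"
  assumes "1 \<le> p" "0 < \<eta>" "\<forall>k\<in>{1..K}. 0 \<le> w k" "\<forall>k\<in>{1..K}. psd (\<Sigma> k)"
  shows "(\<integral>\<^sup>+y. ennreal (norm y powr p) \<partial>gaussian_mixture K w \<mu> (\<lambda>k. \<eta> *\<^sub>R \<Sigma> k)) \<le>
    ennreal (2 powr (p - 1) * (\<Sum>k=1..K. w k * norm (\<mu> k) powr p) +
      \<eta> powr (p / 2) * (2 powr (p - 1) * kappa TYPE('d) p * (\<Sum>k=1..K. w k * trace (\<Sigma> k) powr (p / 2))))"
proof -
  let ?b = "\<lambda>k. 2 powr (p - 1) * (norm (\<mu> k) powr p + trace (\<eta> *\<^sub>R \<Sigma> k) powr (p / 2) * kappa TYPE('d) p)"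
  have b: "0 \<le> ?b k" for k
    using kappa_nonneg[of p, where 'd='d] by simp
  have "(\<integral>\<^sup>+y. ennreal (norm y powr p) \<partial>gaussian_mixture K w \<mu> (\<lambda>k. \<eta> *\<^sub>R \<Sigma> k)) =
      (\<Sum>k=1..K. ennreal (w k) * (\<integral>\<^sup>+y. ennreal (norm y powr p) \<partial>gaussian (\<mu> k) (\<eta> *\<^sub>R \<Sigma> k)))"
    by (rule nn_integral_gaussian_mixture) simp
  also have "\<dots> \<le> (\<Sum>k=1..K. ennreal (w k) * ennreal (?b k))"
    using assms by (intro sum_mono mult_left_mono nn_integral_norm_gaussian_le psd_scale) auto
  also have "\<dots> = (\<Sum>k=1..K. ennreal (w k * ?b k))"
    using assms(3) by (intro sum.cong refl ennreal_mult[OF _ b, symmetric]) auto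
  also have "\<dots> = ennreal (\<Sum>k=1..K. w k * ?b k)"
    using assms(3) by (intro sum_ennreal mult_nonneg_nonneg[OF _ b]) auto
  also have "(\<Sum>k=1..K. w k * ?b k) = (\<Sum>k=1..K. 2 powr (p - 1) * (w k * norm (\<mu> k) powr p) +
      \<eta> powr (p / 2) * (2 powr (p - 1) * kappa TYPE('d) p * (w k * trace (\<Sigma> k) powr (p / 2))))"
  proof (intro sum.cong refl)
    fix k assume "k \<in> {1..K}"
    then have "0 \<le> trace (\<Sigma> k)"
      using assms(4) trace_psd_nonneg by blast
    then have "trace (\<eta> *\<^sub>R \<Sigma> k) powr (p / 2) = \<eta> powr (p / 2) * trace (\<Sigma> k) powr (p / 2)"
      using assms(2) by (simp add: trace_scale powr_mult)
    then show "w k * ?b k = 2 powr (p - 1) * (w k * norm (\<mu> k) powr p) +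
      \<eta> powr (p / 2) * (2 powr (p - 1) * kappa TYPE('d) p * (w k * trace (\<Sigma> k) powr (p / 2)))"
      by (simp only: distrib_left mult_ac)
  qed
  finally show ?thesis
    by (simp only: sum.distrib sum_distrib_left)
qed

lemma (in prob_space) markov_powr:
  assumes [measurable]: "Y \<in> borel_measurable M" and "0 < p" "0 < U" "0 \<le> c"
    and "\<And>\<omega>. \<omega> \<in> space M \<Longrightarrow> 0 \<le> Y \<omega>"
    and le: "(\<integral>\<^sup>+\<omega>. ennreal (Y \<omega> powr p) \<partial>M) \<le> ennreal c"
  shows "measure M {\<omega> \<in> space M. U < Y \<omega>} \<le> c / U powr p"
proof -
  let ?A = "{\<omega> \<in> space M. U < Y \<omega>}"
  have "ennreal (U powr p) * emeasure M ?A = (\<integral>\<^sup>+\<omega>. ennreal (U powr p) * indicator ?A \<omega> \<partial>M)"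
    by (rule nn_integral_cmult_indicator[symmetric]) simp
  also have "\<dots> \<le> (\<integral>\<^sup>+\<omega>. ennreal (Y \<omega> powr p) \<partial>M)"
    using assms by (intro nn_integral_mono) (auto simp: indicator_def intro!: ennreal_leI powr_mono2)
  also have "\<dots> \<le> ennreal c"
    by (rule le)
  finally have "U powr p * measure M ?A \<le> c"
    using \<open>0 \<le> c\<close> by (simp add: emeasure_eq_measure ennreal_mult[symmetric])
  then show ?thesis
    using \<open>0 < U\<close> by (simp add: field_simps)
qed

theorem corollary6:
  fixes M :: "'w measure"
    and K N l :: nat
    and p :: real
    and w :: "nat \<Rightarrow> real"
    and \<mu> :: "nat \<Rightarrow> real ^ 'd"
    and \<Sigma> :: "nat \<Rightarrow> real ^ 'd ^ 'd"
    and X :: "real \<Rightarrow> nat \<Rightarrow> 'w \<Rightarrow> real ^ 'd"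
    and L :: "(nat \<Rightarrow> real ^ 'd) \<Rightarrow> real"
  assumes "prob_space M"
    and "K \<ge> 1" and "N \<ge> 1" and "p \<ge> 1"
    and "\<forall>k\<in>{1..K}. w k \<ge> 0" and "(\<Sum>k=1..K. w k) = 1"
    and "\<forall>k\<in>{1..K}. psd (\<Sigma> k)"
    and "\<forall>\<eta>>0. \<forall>i\<in>{1..N}. X \<eta> i \<in> borel_measurable M"
    and "\<forall>\<eta>>0. \<forall>i\<in>{1..N}.
           distr M borel (X \<eta> i) = gaussian_mixture K w \<mu> (\<lambda>k. \<eta> *\<^sub>R \<Sigma> k)"
    and "L \<in> {L_total N l, L_max N l}"
  shows "tight_family M {1..} (\<lambda>\<eta> \<omega>. L (\<lambda>i. X \<eta> i \<omega>) / sqrt \<eta>)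
    \<and> (\<forall>\<epsilon>>0. \<exists>U>0.
        (SUP \<eta>\<in>{1..}. measure M {\<omega> \<in> space M. L (\<lambda>i. X \<eta> i \<omega>) / sqrt \<eta> > U}) < \<epsilon>)
    \<and> (let M\<^sub>p = 2 powr (p - 1) * (\<Sum>k=1..K. w k * norm (\<mu> k) powr p);
           V\<^sub>p = 2 powr (p - 1) * kappa TYPE('d) p * (\<Sum>k=1..K. w k * trace (\<Sigma> k) powr (p / 2));
           C\<^sub>V\<^sub>R = 2 powr p * real N * real (min (N choose (l + 1)) (N choose (l + 2))) powr p;
           C = (M\<^sub>p + V\<^sub>p) * C\<^sub>V\<^sub>R
       in C > 0 \<longrightarrow>
          (\<forall>\<epsilon>>0. let U = (C / \<epsilon>) powr (1 / p) in U > 0 \<and>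
            (SUP \<eta>\<in>{1..}. measure M {\<omega> \<in> space M. L (\<lambda>i. X \<eta> i \<omega>) / sqrt \<eta> > U}) < \<epsilon>))"
proof -
  interpret prob_space M by fact
  define Mp where "Mp = 2 powr (p - 1) * (\<Sum>k=1..K. w k * norm (\<mu> k) powr p)"
  define Vp where "Vp = 2 powr (p - 1) * kappa TYPE('d) p * (\<Sum>k=1..K. w k * trace (\<Sigma> k) powr (p / 2))"
  define n where "n = real (min (N choose (l + 1)) (N choose (l + 2)))"
  define C where "C = (Mp + Vp) * (2 powr p * real N * n powr p)"
  define Y where "Y \<eta> \<omega> = L (\<lambda>i. X \<eta> i \<omega>) / sqrt \<eta>" for \<eta> \<omega>
  have "0 \<le> Mp" "0 \<le> Vp" "0 \<le> n"
    using assms(5) kappa_nonneg[of p, where 'd='d]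
    by (auto simp: Mp_def Vp_def n_def intro!: mult_nonneg_nonneg sum_nonneg)
  then have "0 \<le> C"
    by (simp add: C_def)
  have X: "X \<eta> i \<in> borel_measurable M" if "1 \<le> \<eta>" "i \<in> {1..N}" for \<eta> i
    using assms(8) that by simp
  have meas: "Y \<eta> \<in> borel_measurable M" if "1 \<le> \<eta>" for \<eta>
    unfolding Y_def using borel_measurable_L[OF X assms(3,10)] that by simp
  have nonneg: "0 \<le> Y \<eta> \<omega>" if "1 \<le> \<eta>" for \<eta> \<omega>
    using L_bounds(1)[OF assms(10,3)] that by (simp add: Y_def)
  have X_moment: "(\<integral>\<^sup>+\<omega>. ennreal (norm (X \<eta> i \<omega>) powr p) \<partial>M) \<le> ennreal (\<eta> powr (p / 2) * (Mp + Vp))"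
    if \<eta>: "1 \<le> \<eta>" and i: "i \<in> {1..N}" for \<eta> i
  proof -
    have "(\<integral>\<^sup>+\<omega>. ennreal (norm (X \<eta> i \<omega>) powr p) \<partial>M) =
        (\<integral>\<^sup>+y. ennreal (norm y powr p) \<partial>distr M borel (X \<eta> i))"
      using X[OF \<eta> i] by (subst nn_integral_distr) simp_all
    also have "distr M borel (X \<eta> i) = gaussian_mixture K w \<mu> (\<lambda>k. \<eta> *\<^sub>R \<Sigma> k)"
      using assms(9) \<eta> i by simp
    also have "(\<integral>\<^sup>+y. ennreal (norm y powr p) \<partial>\<dots>) \<le> ennreal (Mp + \<eta> powr (p / 2) * Vp)"
      unfolding Mp_def Vp_def
      using assms \<eta> by (intro nn_integral_norm_gaussian_mixture_le) auto
    also have "\<dots> \<le> ennreal (\<eta> powr (p / 2) * (Mp + Vp))"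
    proof (rule ennreal_leI)
      \<comment> \<open>Here \<open>1 \<le> \<eta>\<close> is essential: the contribution of the
        means, which does not scale, is absorbed into the growth rate of the fluctuations.\<close>
      have "1 * Mp \<le> \<eta> powr (p / 2) * Mp"
        using \<eta> assms(4) \<open>0 \<le> Mp\<close> by (intro mult_right_mono ge_one_powr_ge_zero) auto
      then show "Mp + \<eta> powr (p / 2) * Vp \<le> \<eta> powr (p / 2) * (Mp + Vp)"
        by (simp add: distrib_left)
    qed
    finally show ?thesis .
  qed
  have Y_moment: "(\<integral>\<^sup>+\<omega>. ennreal (Y \<eta> \<omega> powr p) \<partial>M) \<le> ennreal (C / 2)" if \<eta>: "1 \<le> \<eta>" for \<eta>
  proof -
    \<comment> \<open>The factors come from the number of pairs, from the division by
      \<open>sqrt \<eta>\<close> and from the diameter bound.\<close>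
    let ?a = "n powr p * \<eta> powr (- p / 2) * 2 powr (p - 1)"
    have "Y \<eta> \<omega> powr p \<le> ?a * (\<Sum>i=1..N. norm (X \<eta> i \<omega>) powr p)" for \<omega>
    proof -
      let ?v = "vietoris_rips (\<lambda>i. X \<eta> i \<omega>) {1..N}"
      have "{1..N} \<in> full_simplex N"
        using assms(3) by (auto simp: full_simplex_def)
      then have v: "0 \<le> ?v"
        by (rule vietoris_rips_nonneg)
      have "Y \<eta> \<omega> \<le> n * ?v / sqrt \<eta>"
        using L_bounds(2)[OF assms(10,3)] \<eta> by (simp add: Y_def n_def divide_right_mono)
      then have "Y \<eta> \<omega> powr p \<le> (n * ?v / sqrt \<eta>) powr p"
        using nonneg[OF \<eta>] assms(4) by (intro powr_mono2) auto
      also have "\<dots> = n powr p * \<eta> powr (- p / 2) * ?v powr p"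
        using v \<open>0 \<le> n\<close> \<eta>
        by (simp add: powr_divide powr_mult powr_half_sqrt[symmetric] powr_powr powr_minus_divide)
      also have "\<dots> \<le> n powr p * \<eta> powr (- p / 2) * (2 powr (p - 1) * (\<Sum>i=1..N. norm (X \<eta> i \<omega>) powr p))"
        using assms(3,4) by (intro mult_left_mono vietoris_rips_powr_le) auto
      finally show ?thesis
        by (simp only: mult.assoc)
    qed
    then have "(\<integral>\<^sup>+\<omega>. ennreal (Y \<eta> \<omega> powr p) \<partial>M) \<le>
        (\<integral>\<^sup>+\<omega>. ennreal (?a * (\<Sum>i=1..N. norm (X \<eta> i \<omega>) powr p)) \<partial>M)"
      by (intro nn_integral_mono ennreal_leI)
    also have "\<dots> = (\<integral>\<^sup>+\<omega>. ennreal ?a * (\<Sum>i=1..N. ennreal (norm (X \<eta> i \<omega>) powr p)) \<partial>M)"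
      by (simp add: ennreal_mult sum_nonneg)
    also have "\<dots> = ennreal ?a * (\<Sum>i=1..N. \<integral>\<^sup>+\<omega>. ennreal (norm (X \<eta> i \<omega>) powr p) \<partial>M)"
    proof -
      have m: "(\<lambda>\<omega>. ennreal (norm (X \<eta> i \<omega>) powr p)) \<in> borel_measurable M" if "i \<in> {1..N}" for i
        using X[OF \<eta> that] by simp
      have "(\<integral>\<^sup>+\<omega>. (\<Sum>i=1..N. ennreal (norm (X \<eta> i \<omega>) powr p)) \<partial>M) =
          (\<Sum>i=1..N. \<integral>\<^sup>+\<omega>. ennreal (norm (X \<eta> i \<omega>) powr p) \<partial>M)"
        by (rule nn_integral_sum[OF m])
      then show ?thesis
        by (subst nn_integral_cmult) (simp_all only: borel_measurable_sum m)
    qed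
    also have "\<dots> \<le> ennreal ?a * (\<Sum>i=1..N. ennreal (\<eta> powr (p / 2) * (Mp + Vp)))"
      by (intro mult_left_mono sum_mono X_moment \<eta>) auto
    also have "\<dots> = ennreal (?a * (real N * (\<eta> powr (p / 2) * (Mp + Vp))))"
      using \<open>0 \<le> Mp\<close> \<open>0 \<le> Vp\<close> by (simp add: ennreal_mult ennreal_of_nat_eq_real_of_nat)
    \<comment> \<open>The powers of \<eta> cancel, which makes the bound uniform. The half remains
      because \<open>C\<close> carries \<open>2 powr p\<close> and the estimate only
      \<open>2 powr (p - 1)\<close>.\<close>
    also have "?a * (real N * (\<eta> powr (p / 2) * (Mp + Vp))) = C / 2"
    proof -
      have "?a * (real N * (\<eta> powr (p / 2) * (Mp + Vp))) =
          (\<eta> powr (- p / 2) * \<eta> powr (p / 2)) * (2 powr (p - 1) * (n powr p * real N * (Mp + Vp)))"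
        by (simp only: mult_ac)
      also have "\<eta> powr (- p / 2) * \<eta> powr (p / 2) = 1"
        using \<eta> by (simp add: powr_add[symmetric])
      also have "1 * (2 powr (p - 1) * (n powr p * real N * (Mp + Vp))) = C / 2"
        by (simp add: C_def powr_diff)
      finally show ?thesis .
    qed
    finally show ?thesis .
  qed
  have tail: "measure M {\<omega> \<in> space M. U < Y \<eta> \<omega>} \<le> C / 2 / U powr p" if "1 \<le> \<eta>" "0 < U" for \<eta> U
    using that assms(4) \<open>0 \<le> C\<close> by (intro markov_powr meas nonneg Y_moment) auto
  have half: "C / 2 / U powr p \<le> \<epsilon> / 2" if "0 < \<epsilon>" "0 < U" "C \<le> U powr p * \<epsilon>" for U \<epsilon>
    using that by (simp add: field_simps)
  \<comment> \<open>A supremum of numbers below \<epsilon> could still equal \<epsilon>; the uniform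
    bound \<open>\<epsilon> / 2\<close> leaves a gap.\<close>
  have SUP_tail: "(SUP \<eta>\<in>{1..}. measure M {\<omega> \<in> space M. U < Y \<eta> \<omega>}) < \<epsilon>"
    if "0 < \<epsilon>" "0 < U" "C \<le> U powr p * \<epsilon>" for U \<epsilon>
  proof -
    have "(SUP \<eta>\<in>{1..}. measure M {\<omega> \<in> space M. U < Y \<eta> \<omega>}) \<le> \<epsilon> / 2"
      by (intro cSUP_least order_trans[OF tail[OF _ that(2)] half[OF that]]) auto
    then show ?thesis
      using that(1) by simp
  qed
  have root: "((c / \<epsilon>) powr (1 / p)) powr p * \<epsilon> = c" if "0 < \<epsilon>" "0 \<le> c" for c \<epsilon> :: real
    using that assms(4) by (simp add: powr_powr)
  \<comment> \<open>\<open>max C 1\<close> covers \<open>C = 0\<close>, where the explicit threshold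
    would be 0 instead of positive.\<close>
  have ex: "\<exists>U>0. C \<le> U powr p * \<epsilon>" if "0 < \<epsilon>" for \<epsilon>
    using root[of \<epsilon> "max C 1"] that
    by (intro exI[of _ "(max C 1 / \<epsilon>) powr (1 / p)"]) (auto simp: max_def split: if_splits)
  have "tight_family M {1..} Y"
    unfolding tight_family_def
  proof (intro conjI ballI allI impI)
    show "Y \<eta> \<in> borel_measurable M" if "\<eta> \<in> {1..}" for \<eta>
      using meas that by simp
  next
    fix \<epsilon> :: real assume "0 < \<epsilon>"
    then obtain U where U: "0 < U" "C \<le> U powr p * \<epsilon>"
      using ex by blast
    have "measure (distr M borel (Y \<eta>)) (- {0..U}) < \<epsilon>" if "\<eta> \<in> {1..}" for \<eta>
    proof -
      have \<eta>: "1 \<le> \<eta>" using that by simp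
      have "measure (distr M borel (Y \<eta>)) (- {0..U}) = measure M (Y \<eta> -` (- {0..U}) \<inter> space M)"
        using meas[OF \<eta>] by (intro measure_distr) auto
      \<comment> \<open>By nonnegativity, leaving the compact interval means exceeding its upper
        end.\<close>
      also have "Y \<eta> -` (- {0..U}) \<inter> space M = {\<omega> \<in> space M. U < Y \<eta> \<omega>}"
        using nonneg[OF \<eta>] by (auto simp: not_le)
      also have "measure M \<dots> \<le> C / 2 / U powr p"
        by (rule tail[OF \<eta> U(1)])
      also have "\<dots> \<le> \<epsilon> / 2"
        by (rule half[OF \<open>0 < \<epsilon>\<close> U])
      also have "\<dots> < \<epsilon>"
        using \<open>0 < \<epsilon>\<close> by simp
      finally show ?thesis .
    qed
    then show "\<exists>S. compact S \<and> (\<forall>\<eta>\<in>{1..}. measure (distr M borel (Y \<eta>)) (- S) < \<epsilon>)"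
      by (intro exI[of _ "{0..U}"]) auto
  qed
  moreover have "\<exists>U>0. (SUP \<eta>\<in>{1..}. measure M {\<omega> \<in> space M. U < Y \<eta> \<omega>}) < \<epsilon>" if "0 < \<epsilon>" for \<epsilon>
    using ex[OF that] SUP_tail[OF that] by blast
  moreover have "0 < (C / \<epsilon>) powr (1 / p) \<and>
      (SUP \<eta>\<in>{1..}. measure M {\<omega> \<in> space M. (C / \<epsilon>) powr (1 / p) < Y \<eta> \<omega>}) < \<epsilon>"
    if "0 < C" "0 < \<epsilon>" for \<epsilon>
    using that root[of \<epsilon> C] SUP_tail[of \<epsilon> "(C / \<epsilon>) powr (1 / p)"] by simp
  ultimately show ?thesis
    unfolding Let_def Y_def C_def Mp_def Vp_def n_def by blast
qed

end
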